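(* Let $(\mathbf Q_h^n,u_h^n,s^n)_{n\ge0}$ be generated by the first-order exponential time differencing (EOP-GSAV-EI) scheme defined in the context, and let $G_*>0$ be the uniform lower bound of the scalar factors, $g^n\ge G_*$ for all $n\ge 0$. Let $b_2=0$, $b_3=\frac{|B|}{\sqrt6}$, and let $\eta^{(d)}>0$ be chosen sufficiently large that $f_d(\eta^{(d)})\le 0$, where $f_d(\xi)=-A\xi+b_d\xi^2-C\xi^3+S$. Assume $\|\mathbf Q_h^0\|_\infty\le\eta^{(d)}$ and $\kappa_1\ge\frac1{G_*}\kappa_0$, where $$\kappa_0=\max\Big\{\sup_x\tilde A(x)+C(\eta^{(d)})^2,\ \max_{\xi\in[0,\eta^{(d)}]}\big(A-2b_d\xi+3C\xi^2\big)\Big\}.$$ Then $$\|\mathbf Q_h^n\|_\infty\le\eta^{(d)}\qquad\text{for all } n\ge0 .$$ Here $\tilde A=A+\frac{2B_0q^4}{s_+^2}(u_h^n)^2$ (the supremum being over all grid points and all time levels $n$) and $S<\infty$ is the bound of the forcing term, $S=\sup_n\big\|\frac{2B_0q^2}{s_+}\big(u_h^nD_h^2u_h^n-\frac{\mathrm{tr}(u_h^nD_h^2u_h^n)}d\mathbf I\big)\big\|_\infty$.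
   Context: Grid. Let $d\in\{2,3\}$, $L>0$, $\Omega=[0,L]^d$ with periodic boundary conditions, $J$ a positive integer, $h=L/J$. $E_h^{\mathrm{per}}$ is the space of real grid functions $U=(U_p)$ on the points $hp$, $p\in\{0,\dots,J\}^d$, that are $J$-periodic in each index (and extended periodically). With $e_k$ the $k$-th unit vector, $(D_k^+U)_p=(U_{p+e_k}-U_p)/h$, $(D_k^-U)_p=(U_p-U_{p-e_k})/h$, $(D_k^cU)_p=(U_{p+e_k}-U_{p-e_k})/(2h)$, $D_{k,l}^c=D_k^cD_l^c$; $\Delta_h=\sum_kD_k^+D_k^-$, $\Delta_h^2=\Delta_h\Delta_h$, $D_h^2U=(D_{k,l}^cU)_{k,l}$, and for a matrix-valued grid function $\Phi$, $\nabla_h\cdot(\nabla_h\cdot\Phi)=\sum_{k,l}D_{k,l}^c\Phi^{kl}$. $\langle U,V\rangle_h=h^d\sum_{p\in\{1,\dots,J\}^d}U_pV_p$, $\|U\|_h^2=\langle U,U\rangle_h$. For matrix-valued grid functions all difference operators act entrywise and $\langle\cdot,\cdot\rangle_h$ and squared norms are summed over entries; $\|\Phi\|_\infty=\max_p|\Phi_p|_F$ with $|\cdot|_F$ (also written $|\cdot|$) the Frobenius norm; $:$ is the Frobenius product. $\mathbf S_h^{(d)}$ is the space of grid functions with values in symmetric traceless $d\times d$ real matrices, with all entries in $E_h^{\mathrm{per}}$. Parameters. $A,a\in\mathbb R$; $B,C,b,c,K,B_0,q>0$ (terms with $B$ are absent if $d=2$); $A<B^2/(27C)$ if $d=3$ and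 $A<0$ if $d=2$; $s_+=\frac{B+\sqrt{B^2-24AC}}{4C}$ if $d=3$, $s_+=\sqrt{-2A/C}$ if $d=2$. $f_{bn}(\mathbf Q)=\frac A2\mathrm{tr}(\mathbf Q^2)-\frac B3\mathrm{tr}(\mathbf Q^3)+\frac C4(\mathrm{tr}\,\mathbf Q^2)^2$ (no $B$ term if $d=2$), $f_s(u)=\frac a2u^2+\frac b3u^3+\frac c4u^4$. Scheme. Given $\mathbf Q_h^0\in\mathbf S_h^{(d)}$, $u_h^0\in E_h^{\mathrm{per}}$, $s^0=E_{1h}^0$, $\tau>0$, $\kappa_1,\kappa_2>0$, $\eta_0\in[0,1]$. At step $n$ set $M_h^n=\frac{\mathbf Q_h^n}{s_+}+\frac{\mathbf I_d}{d}$, $E_{1h}^n=2B_0q^2\langle D_h^2u_h^n,M_h^nu_h^n\rangle_h+B_0q^4\|M_h^nu_h^n\|_h^2+\langle f_{bn}(\mathbf Q_h^n),1\rangle_h+\langle f_s(u_h^n),1\rangle_h$, $g^n=e^{s^n}/e^{E_{1h}^n}$, $\mathbf H_h^n=A\mathbf Q_h^n-B\big((\mathbf Q_h^n)^2-\frac{\mathrm{tr}((\mathbf Q_h^n)^2)}{d}\mathbf I\big)+C\,\mathrm{tr}((\mathbf Q_h^n)^2)\mathbf Q_h^n+\frac{2B_0q^2}{s_+}\big(u_h^nD_h^2u_h^n-\frac{\mathrm{tr}(u_h^nD_h^2u_h^n)}{d}\mathbf I\big)+2B_0q^4\frac{\mathbf Q_h^n}{s_+^2}(u_h^n)^2$,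 $\mu_h^n=au_h^n+b(u_h^n)^2+c(u_h^n)^3+2B_0q^2M_h^n:D_h^2u_h^n+2B_0q^2\nabla_h\cdot(\nabla_h\cdot(M_h^nu_h^n))+2B_0q^4|M_h^n|^2u_h^n$, $\mathcal L_h=-K\Delta_h+g^n\kappa_1$ on $\mathbf S_h^{(d)}$, $\mathcal D_h=2B_0\Delta_h^2+g^n\kappa_2$ on $E_h^{\mathrm{per}}$ (symmetric positive definite), $\mathbf N_h^n=-g^n\mathbf H_h^n+g^n\kappa_1\mathbf Q_h^n$, $\mathcal N_h^n=-g^n\mu_h^n+g^n\kappa_2u_h^n$. With $\phi_1(z)=(e^z-1)/z$ and functions of operators defined spectrally, $\mathbf Q_h^{n+1}=e^{-\tau\mathcal L_h}\mathbf Q_h^n+\tau\phi_1(-\tau\mathcal L_h)\mathbf N_h^n$, $u_h^{n+1}=e^{-\tau\mathcal D_h}u_h^n+\tau\phi_1(-\tau\mathcal D_h)\mathcal N_h^n$, $\tilde s^{n+1}=s^n+g^n\big(\langle\mathbf H_h^n,\mathbf Q_h^{n+1}-\mathbf Q_h^n\rangle_h+\langle\mu_h^n,u_h^{n+1}-u_h^n\rangle_h\big)$, $s^{n+1}=\xi^{n+1}\tilde s^{n+1}+(1-\xi^{n+1})E_{1h}^{n+1}$, where $\xi^{n+1}\in[0,1]$ is such that $s^{n+1}-\tilde s^{n+1}\le\eta_0\tau\mathcal R^{n+1}$. Here $\mathcal R^{n+1}=\frac1\tau\big(\langle\mathcal Q_1(\tau\mathcal L_h)\delta\mathbf Q,\delta\mathbf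 Q\rangle_h+\langle\mathcal Q_1(\tau\mathcal D_h)\delta u,\delta u\rangle_h\big)$ with $\delta\mathbf Q=\mathbf Q_h^{n+1}-\mathbf Q_h^n$, $\delta u=u_h^{n+1}-u_h^n$, $\mathcal Q_1(z)=\frac z{e^z-1}+\frac z2$. *)

theory Defs
  imports "HOL-Analysis.Analysis"
begin

section \<open>Parameters\<close>

text \<open>
  The spatial dimension \<open>d\<close> is \<open>CARD('d)\<close>.  Where no argument carries the type \<open>'d\<close>,
  \<open>d\<close> is passed as a natural number.
\<close>

record params =
  pL :: real
  pJ :: nat
  pA :: real
  pB :: real
  pC :: real
  pa :: real
  pb :: real
  pc :: real
  pK :: real
  pB0 :: real
  pq :: real
  ptau :: real
  pkappa1 :: real
  pkappa2 :: real
  peta0 :: real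

definition admissible :: "nat \<Rightarrow> params \<Rightarrow> bool" where
  "admissible d P \<longleftrightarrow>
     d \<in> {2, 3} \<and> pL P > 0 \<and> pJ P > 0 \<and>
     pB P > 0 \<and> pC P > 0 \<and> pb P > 0 \<and> pc P > 0 \<and> pK P > 0 \<and> pB0 P > 0 \<and> pq P > 0 \<and>
     (d = 3 \<longrightarrow> pA P < (pB P)\<^sup>2 / (27 * pC P)) \<and> (d = 2 \<longrightarrow> pA P < 0) \<and>
     ptau P > 0 \<and> pkappa1 P > 0 \<and> pkappa2 P > 0 \<and> 0 \<le> peta0 P \<and> peta0 P \<le> 1"

definition mesh :: "params \<Rightarrow> real" where
  "mesh P = pL P / real (pJ P)"

text \<open>The coefficient of the cubic bulk term; that term is absent in dimension 2.\<close>

definition Bcoef :: "nat \<Rightarrow> params \<Rightarrow> real" where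
  "Bcoef d P = (if d = 3 then pB P else 0)"

definition s_plus :: "nat \<Rightarrow> params \<Rightarrow> real" where
  "s_plus d P =
     (if d = 3 then (pB P + sqrt ((pB P)\<^sup>2 - 24 * pA P * pC P)) / (4 * pC P)
      else sqrt (- 2 * pA P / pC P))"


section \<open>Periodic grid functions\<close>

text \<open>
  A grid function is represented by its \<open>J\<close>-periodic extension to all of \<open>\<int>\<^sup>d\<close>.  On the type
  \<open>real ^ 'd ^ 'd\<close> the library's \<open>norm\<close> and \<open>inner\<close> are the Frobenius norm and product, while
  its \<open>*\<close> and \<open>^\<close> are entrywise; matrix products are written \<open>**\<close>.
\<close>

type_synonym ('d, 'b) grid_fun = "int ^ 'd \<Rightarrow> 'b"
type_synonym 'd matrix_fun = "('d, real ^ 'd ^ 'd) grid_fun"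

definition E_per :: "nat \<Rightarrow> ('d::finite, 'b) grid_fun set" where
  "E_per J = {U. \<forall>p k. U (p + axis k (int J)) = U p}"

definition S_h :: "nat \<Rightarrow> 'd::finite matrix_fun set" where
  "S_h J = {\<Phi> \<in> E_per J. \<forall>p. transpose (\<Phi> p) = \<Phi> p \<and> trace (\<Phi> p) = 0}"

definition grid_points :: "nat \<Rightarrow> (int ^ 'd::finite) set" where
  "grid_points J = {p. \<forall>k. 0 \<le> p $ k \<and> p $ k \<le> int J}"

definition grid_cell :: "nat \<Rightarrow> (int ^ 'd::finite) set" where
  "grid_cell J = {p. \<forall>k. 1 \<le> p $ k \<and> p $ k \<le> int J}"

definition inner_h :: "params \<Rightarrow> ('d::finite, 'b::real_inner) grid_fun \<Rightarrow> ('d, 'b) grid_fun \<Rightarrow> real"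
  where "inner_h P U V = mesh P ^ CARD('d) * (\<Sum>p\<in>grid_cell (pJ P). U p \<bullet> V p)"

definition norm_inf :: "params \<Rightarrow> ('d::finite, 'b::real_normed_vector) grid_fun \<Rightarrow> real" where
  "norm_inf P \<Phi> = Max ((\<lambda>p. norm (\<Phi> p)) ` grid_points (pJ P))"


section \<open>Difference operators\<close>

definition D_plus :: "params \<Rightarrow> 'd \<Rightarrow> ('d::finite, 'b::real_vector) grid_fun \<Rightarrow> ('d, 'b) grid_fun" where
  "D_plus P k U = (\<lambda>p. (U (p + axis k 1) - U p) /\<^sub>R mesh P)"

definition D_minus :: "params \<Rightarrow> 'd \<Rightarrow> ('d::finite, 'b::real_vector) grid_fun \<Rightarrow> ('d, 'b) grid_fun" where
  "D_minus P k U = (\<lambda>p. (U p - U (p - axis k 1)) /\<^sub>R mesh P)"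

definition D_c :: "params \<Rightarrow> 'd \<Rightarrow> ('d::finite, 'b::real_vector) grid_fun \<Rightarrow> ('d, 'b) grid_fun" where
  "D_c P k U = (\<lambda>p. (U (p + axis k 1) - U (p - axis k 1)) /\<^sub>R (2 * mesh P))"

definition Lap :: "params \<Rightarrow> ('d::finite, 'b::real_vector) grid_fun \<Rightarrow> ('d, 'b) grid_fun" where
  "Lap P U = (\<lambda>p. \<Sum>k\<in>UNIV. D_plus P k (D_minus P k U) p)"

definition Hess :: "params \<Rightarrow> ('d::finite, real) grid_fun \<Rightarrow> 'd matrix_fun" where
  "Hess P u = (\<lambda>p. \<chi> k l. D_c P k (D_c P l u) p)"

definition div_div :: "params \<Rightarrow> 'd::finite matrix_fun \<Rightarrow> ('d, real) grid_fun" where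
  "div_div P \<Phi> = (\<lambda>p. \<Sum>k\<in>UNIV. \<Sum>l\<in>UNIV. D_c P k (D_c P l (\<lambda>r. \<Phi> r $ k $ l)) p)"


section \<open>Spectral functional calculus\<close>

text \<open>
  For a symmetric operator \<open>T\<close> on a finite-dimensional space \<open>E\<close> of grid functions,
  \<open>f(T) V\<close> is the sum of \<open>f(\<lambda>) \<Pi>\<^sub>\<lambda> V\<close> over the finitely many eigenvalues \<open>\<lambda>\<close> of \<open>T\<close> on \<open>E\<close>,
  where \<open>\<Pi>\<^sub>\<lambda>\<close> is the \<open>inner_h\<close>-orthogonal projection onto the eigenspace of \<open>\<lambda>\<close>.
\<close>

definition eigenspace ::
  "('d, 'b::real_vector) grid_fun set \<Rightarrow> (('d, 'b) grid_fun \<Rightarrow> ('d, 'b) grid_fun) \<Rightarrow>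
     real \<Rightarrow> ('d::finite, 'b) grid_fun set" where
  "eigenspace E T lam = {V \<in> E. T V = (\<lambda>p. lam *\<^sub>R V p)}"

definition eigenvalues ::
  "('d, 'b::real_vector) grid_fun set \<Rightarrow> (('d::finite, 'b) grid_fun \<Rightarrow> ('d, 'b) grid_fun) \<Rightarrow>
     real set" where
  "eigenvalues E T = {lam. \<exists>V\<in>eigenspace E T lam. V \<noteq> (\<lambda>p. 0)}"

definition eigenproj ::
  "params \<Rightarrow> ('d, 'b::real_inner) grid_fun set \<Rightarrow>
     (('d::finite, 'b) grid_fun \<Rightarrow> ('d, 'b) grid_fun) \<Rightarrow>
     real \<Rightarrow> ('d, 'b) grid_fun \<Rightarrow> ('d, 'b) grid_fun" where
  "eigenproj P E T lam V =
     (THE W. W \<in> eigenspace E T lam \<and>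
             (\<forall>Z\<in>eigenspace E T lam. inner_h P (\<lambda>p. V p - W p) Z = 0))"

definition op_fun ::
  "params \<Rightarrow> ('d, 'b::real_inner) grid_fun set \<Rightarrow> (real \<Rightarrow> real) \<Rightarrow>
     (('d::finite, 'b) grid_fun \<Rightarrow> ('d, 'b) grid_fun) \<Rightarrow>
     ('d, 'b) grid_fun \<Rightarrow> ('d, 'b) grid_fun" where
  "op_fun P E f T V = (\<lambda>p. \<Sum>lam\<in>eigenvalues E T. f lam *\<^sub>R eigenproj P E T lam V p)"

text \<open>At \<open>0\<close> the two scalar functions take the values of their continuous extensions.\<close>

definition phi1 :: "real \<Rightarrow> real" where
  "phi1 z = (if z = 0 then 1 else (exp z - 1) / z)"

definition Q1 :: "real \<Rightarrow> real" where
  "Q1 z = (if z = 0 then 1 else z / (exp z - 1) + z / 2)"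


section \<open>Energy and variational derivatives\<close>

definition f_bn :: "params \<Rightarrow> real ^ 'd ^ 'd::finite \<Rightarrow> real" where
  "f_bn P Q = pA P / 2 * trace (Q ** Q) - Bcoef CARD('d) P / 3 * trace (Q ** Q ** Q)
              + pC P / 4 * (trace (Q ** Q))\<^sup>2"

definition f_s :: "params \<Rightarrow> real \<Rightarrow> real" where
  "f_s P v = pa P / 2 * v\<^sup>2 + pb P / 3 * v ^ 3 + pc P / 4 * v ^ 4"

definition M_h :: "params \<Rightarrow> 'd::finite matrix_fun \<Rightarrow> 'd matrix_fun" where
  "M_h P Q = (\<lambda>p. Q p /\<^sub>R s_plus CARD('d) P + mat 1 /\<^sub>R real CARD('d))"

definition E1_h :: "params \<Rightarrow> 'd::finite matrix_fun \<Rightarrow> ('d, real) grid_fun \<Rightarrow> real" where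
  "E1_h P Q u =
     2 * pB0 P * (pq P)\<^sup>2 * inner_h P (Hess P u) (\<lambda>p. u p *\<^sub>R M_h P Q p)
     + pB0 P * pq P ^ 4 * inner_h P (\<lambda>p. u p *\<^sub>R M_h P Q p) (\<lambda>p. u p *\<^sub>R M_h P Q p)
     + inner_h P (\<lambda>p. f_bn P (Q p)) (\<lambda>p. 1)
     + inner_h P (\<lambda>p. f_s P (u p)) (\<lambda>p. 1)"

definition g_fac :: "params \<Rightarrow> 'd::finite matrix_fun \<Rightarrow> ('d, real) grid_fun \<Rightarrow> real \<Rightarrow> real" where
  "g_fac P Q u s = exp s / exp (E1_h P Q u)"

definition forcing :: "params \<Rightarrow> ('d::finite, real) grid_fun \<Rightarrow> 'd matrix_fun" where
  "forcing P u = (\<lambda>p. (2 * pB0 P * (pq P)\<^sup>2 / s_plus CARD('d) P) *\<^sub>R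
     (u p *\<^sub>R Hess P u p - (trace (u p *\<^sub>R Hess P u p) / real CARD('d)) *\<^sub>R mat 1))"

definition H_h :: "params \<Rightarrow> 'd::finite matrix_fun \<Rightarrow> ('d, real) grid_fun \<Rightarrow> 'd matrix_fun" where
  "H_h P Q u = (\<lambda>p.
     pA P *\<^sub>R Q p
     - Bcoef CARD('d) P *\<^sub>R (Q p ** Q p - (trace (Q p ** Q p) / real CARD('d)) *\<^sub>R mat 1)
     + (pC P * trace (Q p ** Q p)) *\<^sub>R Q p
     + forcing P u p
     + (2 * pB0 P * pq P ^ 4 / (s_plus CARD('d) P)\<^sup>2 * (u p)\<^sup>2) *\<^sub>R Q p)"

definition mu_h ::
  "params \<Rightarrow> 'd::finite matrix_fun \<Rightarrow> ('d, real) grid_fun \<Rightarrow> ('d, real) grid_fun" where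
  "mu_h P Q u = (\<lambda>p.
     pa P * u p + pb P * (u p)\<^sup>2 + pc P * u p ^ 3
     + 2 * pB0 P * (pq P)\<^sup>2 * (M_h P Q p \<bullet> Hess P u p)
     + 2 * pB0 P * (pq P)\<^sup>2 * div_div P (\<lambda>r. u r *\<^sub>R M_h P Q r) p
     + 2 * pB0 P * pq P ^ 4 * (norm (M_h P Q p))\<^sup>2 * u p)"


section \<open>The first-order EOP-GSAV-EI scheme\<close>

text \<open>In the following definitions \<open>g\<close> stands for the scalar factor of the current step.\<close>

definition L_op :: "params \<Rightarrow> real \<Rightarrow> 'd::finite matrix_fun \<Rightarrow> 'd matrix_fun" where
  "L_op P g V = (\<lambda>p. (- pK P) *\<^sub>R Lap P V p + (g * pkappa1 P) *\<^sub>R V p)"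

definition D_op :: "params \<Rightarrow> real \<Rightarrow> ('d::finite, real) grid_fun \<Rightarrow> ('d, real) grid_fun" where
  "D_op P g V = (\<lambda>p. 2 * pB0 P * Lap P (Lap P V) p + g * pkappa2 P * V p)"

definition N_Q ::
  "params \<Rightarrow> real \<Rightarrow> 'd::finite matrix_fun \<Rightarrow> ('d, real) grid_fun \<Rightarrow> 'd matrix_fun" where
  "N_Q P g Q u = (\<lambda>p. (- g) *\<^sub>R H_h P Q u p + (g * pkappa1 P) *\<^sub>R Q p)"

definition N_u ::
  "params \<Rightarrow> real \<Rightarrow> 'd::finite matrix_fun \<Rightarrow> ('d, real) grid_fun \<Rightarrow> ('d, real) grid_fun" where
  "N_u P g Q u = (\<lambda>p. - g * mu_h P Q u p + g * pkappa2 P * u p)"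

definition Q_next ::
  "params \<Rightarrow> real \<Rightarrow> 'd::finite matrix_fun \<Rightarrow> ('d, real) grid_fun \<Rightarrow> 'd matrix_fun" where
  "Q_next P g Q u = (\<lambda>p.
     op_fun P (S_h (pJ P)) (\<lambda>z. exp (- ptau P * z)) (L_op P g) Q p
     + ptau P *\<^sub>R op_fun P (S_h (pJ P)) (\<lambda>z. phi1 (- ptau P * z)) (L_op P g) (N_Q P g Q u) p)"

definition u_next ::
  "params \<Rightarrow> real \<Rightarrow> 'd::finite matrix_fun \<Rightarrow> ('d, real) grid_fun \<Rightarrow> ('d, real) grid_fun" where
  "u_next P g Q u = (\<lambda>p.
     op_fun P (E_per (pJ P)) (\<lambda>z. exp (- ptau P * z)) (D_op P g) u p
     + ptau P * op_fun P (E_per (pJ P)) (\<lambda>z. phi1 (- ptau P * z)) (D_op P g) (N_u P g Q u) p)"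

definition s_tilde ::
  "params \<Rightarrow> real \<Rightarrow> 'd::finite matrix_fun \<Rightarrow> ('d, real) grid_fun \<Rightarrow> real \<Rightarrow>
     'd matrix_fun \<Rightarrow> ('d, real) grid_fun \<Rightarrow> real" where
  "s_tilde P g Q u s Q' u' =
     s + g * (inner_h P (H_h P Q u) (\<lambda>p. Q' p - Q p) + inner_h P (mu_h P Q u) (\<lambda>p. u' p - u p))"

definition R_term ::
  "params \<Rightarrow> real \<Rightarrow> 'd::finite matrix_fun \<Rightarrow> ('d, real) grid_fun \<Rightarrow>
     'd matrix_fun \<Rightarrow> ('d, real) grid_fun \<Rightarrow> real" where
  "R_term P g Q u Q' u' =
     (let dQ = (\<lambda>p. Q' p - Q p); du = (\<lambda>p. u' p - u p) in
      1 / ptau P *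
        (inner_h P (op_fun P (S_h (pJ P)) (\<lambda>z. Q1 (ptau P * z)) (L_op P g) dQ) dQ
         + inner_h P (op_fun P (E_per (pJ P)) (\<lambda>z. Q1 (ptau P * z)) (D_op P g) du) du))"

definition EOP_GSAV_EI ::
  "params \<Rightarrow> (nat \<Rightarrow> 'd::finite matrix_fun) \<Rightarrow> (nat \<Rightarrow> ('d, real) grid_fun) \<Rightarrow>
     (nat \<Rightarrow> real) \<Rightarrow> bool" where
  "EOP_GSAV_EI P Q u s \<longleftrightarrow>
     Q 0 \<in> S_h (pJ P) \<and> u 0 \<in> E_per (pJ P) \<and> s 0 = E1_h P (Q 0) (u 0) \<and>
     (\<forall>n. let g = g_fac P (Q n) (u n) (s n);
              st = s_tilde P g (Q n) (u n) (s n) (Q (Suc n)) (u (Suc n))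
          in Q (Suc n) = Q_next P g (Q n) (u n) \<and>
             u (Suc n) = u_next P g (Q n) (u n) \<and>
             (\<exists>\<xi>. 0 \<le> \<xi> \<and> \<xi> \<le> 1 \<and>
                  s (Suc n) = \<xi> * st + (1 - \<xi>) * E1_h P (Q (Suc n)) (u (Suc n)) \<and>
                  s (Suc n) - st
                    \<le> peta0 P * ptau P * R_term P g (Q n) (u n) (Q (Suc n)) (u (Suc n))))"


section \<open>Quantities in the maximum bound\<close>

text \<open>
  Suprema over all time levels are taken in \<open>ereal\<close>, so that no boundedness is presupposed
  by writing them down.
\<close>

definition b_coef :: "nat \<Rightarrow> params \<Rightarrow> real" where
  "b_coef d P = (if d = 3 then \<bar>pB P\<bar> / sqrt 6 else 0)"

definition A_tilde :: "params \<Rightarrow> ('d::finite, real) grid_fun \<Rightarrow> ('d, real) grid_fun" where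
  "A_tilde P u = (\<lambda>p. pA P + 2 * pB0 P * pq P ^ 4 / (s_plus CARD('d) P)\<^sup>2 * (u p)\<^sup>2)"

definition S_bound :: "params \<Rightarrow> (nat \<Rightarrow> ('d::finite, real) grid_fun) \<Rightarrow> ereal" where
  "S_bound P u = (SUP n. ereal (norm_inf P (forcing P (u n))))"

definition f_d :: "nat \<Rightarrow> params \<Rightarrow> ereal \<Rightarrow> real \<Rightarrow> ereal" where
  "f_d d P S \<xi> = ereal (- pA P * \<xi> + b_coef d P * \<xi>\<^sup>2 - pC P * \<xi> ^ 3) + S"

definition kappa0 :: "params \<Rightarrow> (nat \<Rightarrow> ('d::finite, real) grid_fun) \<Rightarrow> real \<Rightarrow> ereal" where
  "kappa0 P u \<eta> = max
     ((SUP n. SUP p\<in>grid_points (pJ P). ereal (A_tilde P (u n) p)) + ereal (pC P * \<eta>\<^sup>2))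
     (SUP \<xi>\<in>{0..\<eta>}. ereal (pA P - 2 * b_coef CARD('d) P * \<xi> + 3 * pC P * \<xi>\<^sup>2))"

end

theory Submission
  imports Defs
begin

text \<open>
  One step of the scheme is the exact flow at time \<open>\<tau>\<close> of the linear problem
  \<open>Y' = - L Y + N\<close>, \<open>Y(0) = Q\<^sup>n\<close>, with \<open>L = - K \<Delta>\<^sub>h + \<omega>\<close>, \<open>\<omega> = g \<kappa>\<^sub>1\<close> and with the nonlinear
  term \<open>N\<close> frozen at \<open>Q\<^sup>n\<close>.  The pointwise bound \<open>|Y| \<le> \<eta>\<close> is preserved by
  this flow for two reasons.

  The first is a pointwise bound \<open>|N| \<le> \<omega> \<eta>\<close>, which holds as soon as \<open>|Q\<^sup>n| \<le> \<eta>\<close> (\<open>N_Q_bound\<close>).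
  Writing \<open>r = |Q\<^sup>n(p)|\<close>, the first entry of the maximum defining \<open>\<kappa>\<^sub>0\<close> makes the scalar multiplying \<open>Q\<^sup>n\<close> in
  \<open>N\<close> nonnegative, and the deviatoric part of the square of a symmetric traceless \<open>3 \<times> 3\<close> matrix
  has norm exactly \<open>r\<^sup>2 / sqrt 6\<close> (\<open>norm_deviator_square\<close>); in dimension \<open>2\<close> this term is absent.  Hence \<open>|N| / g\<close> is at most
  \<open>\<kappa>\<^sub>1 r + f\<^sub>d(r)\<close>.  The second entry makes this a nondecreasing function of \<open>r\<close> on \<open>[0, \<eta>]\<close>, so it
  is at most \<open>\<kappa>\<^sub>1 \<eta> + f\<^sub>d(\<eta>) \<le> \<kappa>\<^sub>1 \<eta>\<close>.

  The second is a discrete maximum principle.  An explicit Euler step \<open>U - \<epsilon> L U + \<epsilon> N\<close> with small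
  \<open>\<epsilon>\<close> combines \<open>U(p)\<close> and its neighbours with nonnegative weights of total mass \<open>1 - \<epsilon> \<omega>\<close> and adds
  \<open>\<epsilon> N(p)\<close>, of norm at most \<open>\<epsilon> \<omega> \<eta>\<close>; it therefore stays in the ball (\<open>euler_step_bound\<close>).  The flow is
  the limit of \<open>m\<close> such steps of length \<open>\<tau> / m\<close> (\<open>exponential_step_bound\<close>).

  To see this limit, the operator functions in the scheme have to be computed.  The discrete
  Fourier modes of a periodic grid function sum to the function and diagonalise the discrete
  Laplacian, so every operator diagonal in the modes satisfies \<open>f(T) V = \<Sum>\<^sub>k f(\<lambda>\<^sub>k) V\<^sub>k\<close>
  (\<open>op_fun_modes\<close>).  On each mode the Euler iterates are explicit and converge because
  \<open>(1 - \<tau> \<lambda> / m)\<^sup>m\<close> tends to \<open>exp (- \<tau> \<lambda>)\<close>.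

  Finally, the scalar factor equals \<open>1\<close> at the initial time, so that \<open>G \<le> 1\<close> and the hypothesis
  \<open>\<kappa>\<^sub>1 \<ge> \<kappa>\<^sub>0 / G\<close>, together with \<open>\<kappa>\<^sub>1 > 0\<close>, gives \<open>\<kappa>\<^sub>1 \<ge> \<kappa>\<^sub>0\<close>.
\<close>


section \<open>Periodic grid functions\<close>

lemma E_perI: "(\<And>p k. U (p + axis k (int J)) = U p) \<Longrightarrow> U \<in> E_per J"
  by (simp add: E_per_def)

lemma E_perD: "U \<in> E_per J \<Longrightarrow> U (p + axis k (int J)) = U p"
  by (simp add: E_per_def)

lemma E_per_const: "(\<lambda>p. c) \<in> E_per J"
  by (rule E_perI) simp

lemma E_per_map: "U \<in> E_per J \<Longrightarrow> (\<lambda>p. f (U p)) \<in> E_per J"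
  by (rule E_perI) (simp add: E_perD)

lemma E_per_map2: "U \<in> E_per J \<Longrightarrow> V \<in> E_per J \<Longrightarrow> (\<lambda>p. f (U p) (V p)) \<in> E_per J"
  by (rule E_perI) (simp add: E_perD)

lemma E_per_sum: "(\<And>i. i \<in> I \<Longrightarrow> F i \<in> E_per J) \<Longrightarrow> (\<lambda>p. \<Sum>i\<in>I. F i p) \<in> E_per J"
  by (rule E_perI) (simp add: E_perD)

lemma E_per_translate:
  assumes "U \<in> E_per J"
  shows "(\<lambda>p. U (p + q)) \<in> E_per J" "(\<lambda>p. U (p - q)) \<in> E_per J"
proof -
  have "U (p + axis k (int J) + q) = U (p + q)" for p q k
    using E_perD[OF assms, of "p + q" k] by (simp add: ac_simps)
  from this this[where q = "- q"] show "(\<lambda>p. U (p + q)) \<in> E_per J" "(\<lambda>p. U (p - q)) \<in> E_per J"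
    by (auto intro!: E_perI)
qed

lemma E_per_shift_int:
  assumes "U \<in> E_per J"
  shows "U (p + axis k (n * int J)) = U p"
proof -
  have step: "U (q + axis k (int J)) = U q" for q
    using assms by (simp add: E_per_def)
  have nat: "U (q + axis k (int m * int J)) = U q" for m q
  proof (induction m arbitrary: q)
    case 0
    show ?case by (simp add: axis_def zero_vec_def[symmetric])
  next
    case (Suc m)
    have "q + axis k (int (Suc m) * int J) = (q + axis k (int m * int J)) + axis k (int J)"
      by (simp add: vec_eq_iff axis_def algebra_simps)
    then show ?case using step Suc.IH by metis
  qed
  show ?thesis
  proof (cases "n \<ge> 0")
    case True
    then show ?thesis using nat[of p "nat n"] by simp
  next
    case False
    have "(p + axis k (n * int J)) + axis k (int (nat (- n)) * int J) = p"
      using False by (simp add: vec_eq_iff axis_def algebra_simps)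
    then show ?thesis using nat[of "p + axis k (n * int J)" "nat (- n)"] by (simp only:)
  qed
qed

lemma E_per_shift:
  fixes U :: "('d::finite, 'b) grid_fun"
  assumes "U \<in> E_per J"
  shows "U (p + (\<chi> k. m k * int J)) = U p"
proof -
  have "U (p + (\<chi> k. if k \<in> A then m k * int J else 0)) = U p" if "finite A" for A
    using that
  proof induction
    case empty
    show ?case by (simp add: zero_vec_def[symmetric])
  next
    case (insert i A)
    have "p + (\<chi> k. if k \<in> insert i A then m k * int J else 0)
        = (p + (\<chi> k. if k \<in> A then m k * int J else 0)) + axis i (m i * int J)"
      using insert.hyps by (auto simp: vec_eq_iff axis_def)
    then show ?case by (simp only: E_per_shift_int[OF assms] insert.IH)
  qed
  from this[of UNIV] show ?thesis by simp
qed

text \<open>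
  The representative does not depend on the function, so identities between periodic functions
  need only be checked on one cell.
\<close>

lemma E_per_obtain_cell:
  fixes p :: "int ^ 'd::finite"
  assumes "J > 0"
  obtains r where "r \<in> grid_cell J" "\<And>U. U \<in> E_per J \<Longrightarrow> U p = U r"
proof
  define r :: "int ^ 'd" where "r = (\<chi> k. (p $ k - 1) mod int J + 1)"
  show "r \<in> grid_cell J"
    unfolding grid_cell_def
  proof (rule CollectI, rule allI)
    fix k
    have "0 \<le> (p $ k - 1) mod int J" "(p $ k - 1) mod int J < int J"
      using assms by simp_all
    then show "1 \<le> r $ k \<and> r $ k \<le> int J" unfolding r_def by simp
  qed
  have "r + (\<chi> k. ((p $ k - 1) div int J) * int J) = p"
    by (simp add: vec_eq_iff r_def algebra_simps)
  then show "U p = U r" if "U \<in> E_per J" for U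
    using E_per_shift[OF that, of r "\<lambda>k. (p $ k - 1) div int J"] by simp
qed

lemma finite_int_box: "finite {p :: int ^ 'd::finite. \<forall>k. a \<le> p $ k \<and> p $ k \<le> b}"
proof -
  have "{p :: int ^ 'd. \<forall>k. a \<le> p $ k \<and> p $ k \<le> b} \<subseteq> vec_lambda ` (PiE UNIV (\<lambda>_. {a..b}))"
  proof
    fix p :: "int ^ 'd" assume "p \<in> {p. \<forall>k. a \<le> p $ k \<and> p $ k \<le> b}"
    then have "vec_nth p \<in> PiE UNIV (\<lambda>_. {a..b})" by auto
    then show "p \<in> vec_lambda ` (PiE UNIV (\<lambda>_. {a..b}))"
      by (metis image_eqI vec_nth_inverse)
  qed
  moreover have "finite (PiE (UNIV :: 'd set) (\<lambda>_. {a..b}))"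
    by (intro finite_PiE) auto
  ultimately show ?thesis by (meson finite_surj)
qed

lemma finite_grid_cell [simp]: "finite (grid_cell J)"
  unfolding grid_cell_def by (rule finite_int_box)

lemma finite_grid_points [simp]: "finite (grid_points J)"
  unfolding grid_points_def by (rule finite_int_box)

lemma grid_cell_subset_points: "(grid_cell J :: (int ^ 'd::finite) set) \<subseteq> grid_points J"
proof
  fix p :: "int ^ 'd" assume "p \<in> grid_cell J"
  then have "1 \<le> p $ k \<and> p $ k \<le> int J" for k by (simp add: grid_cell_def)
  then have "0 \<le> p $ k \<and> p $ k \<le> int J" for k
    using order_trans[OF zero_le_one] by blast
  then show "p \<in> grid_points J" by (simp add: grid_points_def)
qed

lemma norm_inf_le_iff:
  assumes "pJ P > 0" "U \<in> E_per (pJ P)"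
  shows "norm_inf P U \<le> e \<longleftrightarrow> (\<forall>p. norm (U p) \<le> e)"
proof
  assume le: "norm_inf P U \<le> e"
  show "\<forall>p. norm (U p) \<le> e"
  proof
    fix p
    obtain r where r: "r \<in> grid_cell (pJ P)" "U p = U r"
      using E_per_obtain_cell[OF assms(1)] assms(2) by metis
    have "norm (U r) \<le> norm_inf P U"
      unfolding norm_inf_def using r(1) grid_cell_subset_points by (intro Max_ge) auto
    then show "norm (U p) \<le> e" using le r(2) by simp
  qed
next
  assume le: "\<forall>p. norm (U p) \<le> e"
  have "0 \<in> grid_points (pJ P)" by (simp add: grid_points_def)
  then show "norm_inf P U \<le> e"
    unfolding norm_inf_def using le by (subst Max_le_iff) auto
qed

text \<open>
  Summation by parts on the torus: translation by one unit permutes the cell once the points that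
  leave it on one side are brought back on the other.
\<close>

lemma sum_grid_cell_shift:
  fixes F :: "('d::finite, 'b::comm_monoid_add) grid_fun"
  assumes "J > 0" "F \<in> E_per J"
  shows "(\<Sum>p\<in>grid_cell J. F (p + axis k 1)) = (\<Sum>p\<in>grid_cell J. F p)"
proof -
  define up :: "int ^ 'd \<Rightarrow> int ^ 'd"
    where "up p = p + axis k (if p $ k = int J then 1 - int J else 1)" for p
  define dn :: "int ^ 'd \<Rightarrow> int ^ 'd"
    where "dn p = p + axis k (if p $ k = 1 then int J - 1 else - 1)" for p
  have per: "F (q + axis k (int J)) = F q" for q
    using assms(2) by (simp add: E_per_def)
  have up_cell: "up p \<in> grid_cell J" if "p \<in> grid_cell J" for p
    unfolding grid_cell_def
  proof (rule CollectI, rule allI)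
    fix i
    have "1 \<le> p $ i" "p $ i \<le> int J" using that by (auto simp: grid_cell_def)
    then show "1 \<le> up p $ i \<and> up p $ i \<le> int J"
      by (auto simp: up_def axis_def)
  qed
  have dn_cell: "dn p \<in> grid_cell J" if "p \<in> grid_cell J" for p
    unfolding grid_cell_def
  proof (rule CollectI, rule allI)
    fix i
    have "1 \<le> p $ i" "p $ i \<le> int J" using that by (auto simp: grid_cell_def)
    then show "1 \<le> dn p $ i \<and> dn p $ i \<le> int J"
      using assms(1) by (auto simp: dn_def axis_def)
  qed
  have dn_up: "dn (up p) = p" if "p \<in> grid_cell J" for p
  proof -
    have "1 \<le> p $ k" using that by (simp add: grid_cell_def)
    then show ?thesis by (auto simp: dn_def up_def vec_eq_iff axis_def)
  qed
  have up_dn: "up (dn p) = p" if "p \<in> grid_cell J" for p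
  proof -
    have "p $ k \<le> int J" using that by (simp add: grid_cell_def)
    then show ?thesis by (auto simp: dn_def up_def vec_eq_iff axis_def)
  qed
  have F_up: "F (up p) = F (p + axis k 1)" for p
  proof (cases "p $ k = int J")
    case True
    have "up p + axis k (int J) = p + axis k 1"
      using True by (simp add: up_def vec_eq_iff axis_def)
    then show ?thesis using per[of "up p"] by simp
  qed (simp add: up_def)
  show ?thesis
    by (rule sum.reindex_bij_witness[where i = dn and j = up])
       (auto simp: up_cell dn_cell dn_up up_dn F_up)
qed

text \<open>
  Lets a character sum over the \<open>d\<close>-dimensional cell be computed one coordinate at a time.
\<close>

lemma sum_grid_cell_prod:
  fixes F :: "'d::finite \<Rightarrow> int \<Rightarrow> 'c::comm_semiring_1"
  shows "(\<Sum>k\<in>grid_cell J. \<Prod>i\<in>UNIV. F i (k $ i)) = (\<Prod>i\<in>UNIV. \<Sum>j=1..int J. F i j)"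
proof -
  have "(\<Sum>k\<in>grid_cell J. \<Prod>i\<in>UNIV. F i (k $ i))
      = (\<Sum>k\<in>PiE UNIV (\<lambda>_. {1..int J}). \<Prod>i\<in>UNIV. F i (k i))"
    by (rule sum.reindex_bij_witness[where i = vec_lambda and j = vec_nth])
       (auto simp: grid_cell_def)
  then show ?thesis by (simp add: prod_sum_PiE)
qed

lemma sum_roots_of_unity:
  assumes "J > 0" "\<bar>m\<bar> < int J"
  shows "(\<Sum>j=1..int J. cis (2 * pi / real J * (of_int j * of_int m))) = (if m = 0 then of_nat J else 0)"
proof (cases "m = 0")
  case True
  then show ?thesis using assms by simp
next
  case False
  define z where "z = cis (2 * pi / real J * of_int m)"
  have zJ: "z ^ J = 1"
  proof -
    have "z ^ J = cis (2 * pi * of_int m)"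
      using assms unfolding z_def by (simp add: Complex.DeMoivre)
    then show ?thesis by (simp add: cis_multiple_2pi)
  qed
  have z1: "z \<noteq> 1"
  proof
    assume "z = 1"
    then have "cos (2 * pi / real J * of_int m) = 1"
      unfolding z_def by (metis cis.simps(1) one_complex.simps(1))
    then obtain n :: int where "2 * pi / real J * of_int m = of_int n * 2 * pi"
      by (auto simp: cos_one_2pi_int)
    then have "of_int m = (of_int (n * int J) :: real)"
      using assms by (simp add: field_simps)
    then have "m = n * int J" by linarith
    then show False using assms False dvd_imp_le_int[of m "int J"] by simp
  qed
  have "(\<Sum>j=1..int J. cis (2 * pi / real J * (of_int j * of_int m))) = (\<Sum>j=1..J. z ^ j)"
    by (rule sum.reindex_bij_witness[where i = int and j = nat])
       (auto simp: z_def Complex.DeMoivre algebra_simps)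
  also have "\<dots> = (z - z ^ Suc J) / (1 - z)"
    using z1 assms by (simp add: sum_gp)
  also have "\<dots> = 0" by (simp add: zJ)
  finally show ?thesis using False by simp
qed


section \<open>Discrete Fourier modes and the discrete Laplacian\<close>

definition phase :: "nat \<Rightarrow> int ^ 'd::finite \<Rightarrow> int ^ 'd \<Rightarrow> real" where
  "phase J k p = 2 * pi / real J * of_int (\<Sum>i\<in>UNIV. k $ i * p $ i)"

text \<open>
  The component of \<open>V\<close> of frequency \<open>k\<close>, as the convolution of \<open>V\<close> with a cosine instead of a
  complex exponential.  Frequencies \<open>k\<close> and \<open>-k\<close> then give the same function, which does no harm as
  they belong to the same eigenvalue; in return, everything stays real and every mode takes its
  values in any linear subspace containing those of \<open>V\<close>.
\<close>

definition fourier_mode ::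
  "nat \<Rightarrow> int ^ 'd::finite \<Rightarrow> ('d, 'b::real_vector) grid_fun \<Rightarrow> ('d, 'b) grid_fun" where
  "fourier_mode J k V =
     (\<lambda>p. (\<Sum>r\<in>grid_cell J. cos (phase J k (p - r)) *\<^sub>R V r) /\<^sub>R real J ^ CARD('d))"

lemma phase_add: "phase J k (p + q) = phase J k p + phase J k q"
  by (simp add: phase_def algebra_simps sum.distrib)

lemma phase_diff: "phase J k (p - q) = phase J k p - phase J k q"
  by (simp add: phase_def algebra_simps sum_subtractf)

lemma phase_axis: "phase J k (axis i m) = 2 * pi / real J * (of_int (k $ i) * of_int m)"
proof -
  have "(\<Sum>j\<in>UNIV. k $ j * axis i m $ j) = (\<Sum>j\<in>UNIV. if j = i then k $ i * m else 0)"
    by (rule sum.cong) (auto simp: axis_def)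
  then show ?thesis by (simp add: phase_def)
qed

lemma fourier_mode_E_per: "J > 0 \<Longrightarrow> fourier_mode J k V \<in> E_per J"
proof -
  assume J: "J > 0"
  have "cos (phase J k (p + axis i (int J) - r)) = cos (phase J k (p - r))" for p i r
  proof -
    have "phase J k (p + axis i (int J) - r) = phase J k (p - r) + 2 * pi * of_int (k $ i)"
      using J by (simp add: phase_add phase_diff phase_axis)
    moreover have "sin (2 * pi * of_int (k $ i)) = 0" "cos (2 * pi * of_int (k $ i)) = 1"
      by (auto simp: sin_int_2pin cos_int_2pin)
    ultimately show ?thesis by (simp add: cos_add)
  qed
  then show ?thesis by (simp add: fourier_mode_def E_per_def)
qed

text \<open>
  The addition theorem for the cosine; this is what makes a mode an eigenfunction of every
  operator built from symmetric differences.
\<close>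

lemma fourier_mode_neighbours:
  "fourier_mode J k V (p + axis i 1) + fourier_mode J k V (p - axis i 1)
     = (2 * cos (2 * pi / real J * of_int (k $ i))) *\<^sub>R fourier_mode J k V p"
proof -
  have "cos (phase J k (p + axis i 1 - r)) + cos (phase J k (p - axis i 1 - r))
      = 2 * cos (2 * pi / real J * of_int (k $ i)) * cos (phase J k (p - r))" for r
  proof -
    have "phase J k (p + axis i 1 - r) = phase J k (p - r) + 2 * pi / real J * of_int (k $ i)"
      "phase J k (p - axis i 1 - r) = phase J k (p - r) - 2 * pi / real J * of_int (k $ i)"
      by (simp_all add: phase_add phase_diff phase_axis)
    then show ?thesis by (simp add: cos_add cos_diff)
  qed
  then have "cos (phase J k (p + axis i 1 - r)) *\<^sub>R V r + cos (phase J k (p - axis i 1 - r)) *\<^sub>R V r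
      = (2 * cos (2 * pi / real J * of_int (k $ i))) *\<^sub>R (cos (phase J k (p - r)) *\<^sub>R V r)" for r
    by (simp only: scaleR_add_left[symmetric] scaleR_scaleR)
  then have "(\<Sum>r\<in>grid_cell J. cos (phase J k (p + axis i 1 - r)) *\<^sub>R V r)
      + (\<Sum>r\<in>grid_cell J. cos (phase J k (p - axis i 1 - r)) *\<^sub>R V r)
      = (2 * cos (2 * pi / real J * of_int (k $ i))) *\<^sub>R
          (\<Sum>r\<in>grid_cell J. cos (phase J k (p - r)) *\<^sub>R V r)"
    by (simp only: sum.distrib[symmetric] scaleR_sum_right)
  then show ?thesis
    unfolding fourier_mode_def scaleR_add_right[symmetric] by (simp add: mult.commute)
qed

text \<open>
  Orthogonality of characters.  The complex exponential factors over the coordinates, and each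
  factor is a sum of roots of unity; the cosine is its real part.
\<close>

lemma sum_cos_phase:
  fixes p r :: "int ^ 'd::finite"
  assumes "J > 0" "p \<in> grid_cell J" "r \<in> grid_cell J"
  shows "(\<Sum>k\<in>grid_cell J. cos (phase J k (p - r))) = (if r = p then real J ^ CARD('d) else 0)"
proof -
  have small: "\<bar>(p - r) $ i\<bar> < int J" for i
  proof -
    have "1 \<le> p $ i" "p $ i \<le> int J" "1 \<le> r $ i" "r $ i \<le> int J"
      using assms by (auto simp: grid_cell_def)
    then show ?thesis by simp
  qed
  have cis_phase: "cis (phase J k m) = (\<Prod>i\<in>UNIV. cis (2 * pi / real J * (of_int (k $ i) * of_int (m $ i))))"
    for k m :: "int ^ 'd"
  proof -
    have "(\<Prod>i\<in>A. cis (h i)) = cis (\<Sum>i\<in>A. h i)" if "finite A" for A :: "'d set" and h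
      using that by induction (simp_all add: cis_mult)
    from this[of UNIV] show ?thesis by (simp add: phase_def sum_distrib_left)
  qed
  have "(\<Sum>k\<in>grid_cell J. cis (phase J k (p - r)))
      = (\<Prod>i\<in>UNIV. if (p - r) $ i = 0 then of_nat J else 0)"
    unfolding cis_phase sum_grid_cell_prod[where F = "\<lambda>i j. cis (2 * pi / real J * (of_int j * of_int ((p - r) $ i)))"]
    by (rule prod.cong[OF refl]) (rule sum_roots_of_unity[OF assms(1) small])
  also have "\<dots> = (if r = p then of_nat J ^ CARD('d) else 0)"
  proof (cases "r = p")
    case False
    then obtain i where "r $ i \<noteq> p $ i" by (auto simp: vec_eq_iff)
    then have "\<exists>i\<in>UNIV. (if (p - r) $ i = 0 then of_nat J else 0) = (0 :: complex)" by auto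
    then show ?thesis using False by (simp add: prod_zero)
  qed simp
  finally have "Re (\<Sum>k\<in>grid_cell J. cis (phase J k (p - r)))
      = Re (if r = p then of_nat J ^ CARD('d) else 0)" by simp
  moreover have "Re (of_nat J ^ CARD('d)) = real J ^ CARD('d)"
    by (metis Re_complex_of_real of_real_of_nat_eq of_real_power)
  ultimately show ?thesis by (simp split: if_splits)
qed

text \<open>
  Fourier inversion: exchanging the two sums leaves a character sum that picks out the single
  point \<open>r = p\<close> of the cell.
\<close>

lemma sum_fourier_modes:
  fixes V :: "('d::finite, 'b::real_vector) grid_fun"
  assumes "J > 0" "V \<in> E_per J"
  shows "(\<Sum>k\<in>grid_cell J. fourier_mode J k V p) = V p"
proof -
  have on_cell: "(\<Sum>k\<in>grid_cell J. fourier_mode J k V p) = V p" if p: "p \<in> grid_cell J" for p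
  proof -
    have "(\<Sum>k\<in>grid_cell J. \<Sum>r\<in>grid_cell J. cos (phase J k (p - r)) *\<^sub>R V r)
        = (\<Sum>r\<in>grid_cell J. (\<Sum>k\<in>grid_cell J. cos (phase J k (p - r))) *\<^sub>R V r)"
      by (subst sum.swap) (simp add: scaleR_sum_left)
    also have "\<dots> = (\<Sum>r\<in>grid_cell J. if r = p then real J ^ CARD('d) *\<^sub>R V r else 0)"
      using p assms(1) by (intro sum.cong) (auto simp: sum_cos_phase)
    also have "\<dots> = real J ^ CARD('d) *\<^sub>R V p" using p by simp
    finally show ?thesis
      using assms(1) unfolding fourier_mode_def scaleR_sum_right[symmetric] by simp
  qed
  obtain r where r: "r \<in> grid_cell J" "\<And>U :: ('d, 'b) grid_fun. U \<in> E_per J \<Longrightarrow> U p = U r"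
    using E_per_obtain_cell[OF assms(1)] by metis
  have "(\<lambda>p. \<Sum>k\<in>grid_cell J. fourier_mode J k V p) \<in> E_per J"
    by (intro E_per_sum fourier_mode_E_per[OF assms(1)])
  from r(2)[OF this] r(2)[OF assms(2)] on_cell[OF r(1)] show ?thesis by simp
qed

lemma Lap_eq:
  "Lap P U p = (\<Sum>i\<in>UNIV. U (p + axis i 1) + U (p - axis i 1) - 2 *\<^sub>R U p) /\<^sub>R (mesh P)\<^sup>2"
proof -
  have "D_plus P i (D_minus P i U) p
      = (U (p + axis i 1) + U (p - axis i 1) - 2 *\<^sub>R U p) /\<^sub>R (mesh P)\<^sup>2" for i
    unfolding D_plus_def D_minus_def scaleR_diff_right[symmetric] scaleR_scaleR
    by (simp add: power2_eq_square scaleR_2 diff_diff_eq2 add_diff_eq diff_add_eq)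
  then show ?thesis by (simp add: Lap_def scaleR_sum_right)
qed

lemma Lap_E_per: "U \<in> E_per J \<Longrightarrow> Lap P U \<in> E_per J"
  unfolding Lap_eq[abs_def]
  by (intro E_per_map[where f = "\<lambda>x. x /\<^sub>R _"] E_per_sum E_per_map2[where f = "(-)"]
      E_per_map2[where f = "(+)"] E_per_map[where f = "scaleR 2"] E_per_translate)

lemma Lap_add: "Lap P (\<lambda>p. U p + V p) = (\<lambda>p. Lap P U p + Lap P V p)"
  unfolding Lap_eq[abs_def] scaleR_add_right[symmetric] sum.distrib[symmetric]
  by (simp add: algebra_simps)

lemma Lap_scale: "Lap P (\<lambda>p. c *\<^sub>R U p) = (\<lambda>p. c *\<^sub>R Lap P U p)"
  unfolding Lap_eq[abs_def] by (simp add: scaleR_sum_right algebra_simps)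

text \<open>The eigenvalue of \<open>- \<Delta>\<^sub>h\<close> on the mode \<open>k\<close>.\<close>

definition lap_symbol :: "params \<Rightarrow> int ^ 'd::finite \<Rightarrow> real" where
  "lap_symbol P k = (\<Sum>i\<in>UNIV. 2 - 2 * cos (2 * pi / real (pJ P) * of_int (k $ i))) / (mesh P)\<^sup>2"

lemma lap_symbol_nonneg: "lap_symbol P k \<ge> 0"
  unfolding lap_symbol_def by (intro divide_nonneg_nonneg sum_nonneg) auto

lemma Lap_fourier_mode:
  "Lap P (fourier_mode (pJ P) k V) = (\<lambda>p. (- lap_symbol P k) *\<^sub>R fourier_mode (pJ P) k V p)"
proof
  fix p
  show "Lap P (fourier_mode (pJ P) k V) p = (- lap_symbol P k) *\<^sub>R fourier_mode (pJ P) k V p"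
    unfolding Lap_eq fourier_mode_neighbours scaleR_diff_left[symmetric] lap_symbol_def
      scaleR_sum_left[symmetric]
    by (simp add: sum_subtractf divide_inverse algebra_simps)
qed


section \<open>The discrete inner product\<close>

lemma inner_h_commute: "inner_h P U V = inner_h P V U"
  by (simp add: inner_h_def inner_commute)

lemma inner_h_scale_left: "inner_h P (\<lambda>p. c *\<^sub>R U p) V = c * inner_h P U V"
  by (simp add: inner_h_def sum_distrib_left mult_ac)

lemma inner_h_add_left: "inner_h P (\<lambda>p. U p + W p) V = inner_h P U V + inner_h P W V"
  by (simp add: inner_h_def inner_add_left sum.distrib algebra_simps)

lemma inner_h_diff_left: "inner_h P (\<lambda>p. U p - W p) V = inner_h P U V - inner_h P W V"
  by (simp add: inner_h_def inner_diff_left sum_subtractf algebra_simps)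

lemma inner_h_sum_left: "inner_h P (\<lambda>p. \<Sum>k\<in>I. W k p) V = (\<Sum>k\<in>I. inner_h P (W k) V)"
  unfolding inner_h_def inner_sum_left
  by (subst sum.swap) (simp add: sum_distrib_left)

lemma inner_h_eq_0D:
  fixes U :: "('d::finite, 'b::real_inner) grid_fun"
  assumes "pJ P > 0" "mesh P > 0" "U \<in> E_per (pJ P)" "inner_h P U U = 0"
  shows "U p = 0"
proof -
  obtain r where r: "r \<in> grid_cell (pJ P)" "U p = U r"
    using E_per_obtain_cell[OF assms(1)] assms(3) by metis
  have "(\<Sum>p\<in>grid_cell (pJ P). U p \<bullet> U p) = 0"
    using assms(2,4) by (simp add: inner_h_def)
  then have "U r \<bullet> U r = 0"
    using r(1) by (subst (asm) sum_nonneg_eq_0_iff) auto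
  then show ?thesis using r(2) by simp
qed

lemma inner_h_shift:
  assumes "pJ P > 0" "U \<in> E_per (pJ P)" "V \<in> E_per (pJ P)"
  shows "inner_h P (\<lambda>p. U (p + axis i 1)) V = inner_h P U (\<lambda>p. V (p - axis i 1))"
proof -
  have "(\<lambda>p. U p \<bullet> V (p - axis i 1)) \<in> E_per (pJ P)"
    using E_per_translate(2)[OF assms(3), of "axis i 1"] assms(2) by (simp add: E_per_def)
  from sum_grid_cell_shift[OF assms(1) this, of i] show ?thesis
    by (simp add: inner_h_def)
qed

text \<open>
  Forward and backward translation are adjoint to each other, and the Laplacian contains both with
  the same weight.
\<close>

lemma Lap_symmetric:
  assumes J: "pJ P > 0" and U: "U \<in> E_per (pJ P)" and V: "V \<in> E_per (pJ P)"
  shows "inner_h P (Lap P U) V = inner_h P U (Lap P V)"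
proof -
  have expand: "inner_h P (Lap P X) Y = (\<Sum>i\<in>UNIV. inner_h P (\<lambda>p. X (p + axis i 1)) Y
      + inner_h P (\<lambda>p. X (p - axis i 1)) Y - 2 * inner_h P X Y) / (mesh P)\<^sup>2" for X Y
  proof -
    have "inner_h P (Lap P X) Y = inverse ((mesh P)\<^sup>2) *
        inner_h P (\<lambda>p. \<Sum>i\<in>UNIV. X (p + axis i 1) + X (p - axis i 1) - 2 *\<^sub>R X p) Y"
      unfolding Lap_eq[abs_def] by (rule inner_h_scale_left)
    then show ?thesis
      unfolding inner_h_sum_left inner_h_diff_left inner_h_add_left inner_h_scale_left
      by (simp add: divide_inverse mult.commute)
  qed
  have "inner_h P (\<lambda>p. U (p + axis i 1)) V + inner_h P (\<lambda>p. U (p - axis i 1)) V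
      = inner_h P (\<lambda>p. V (p + axis i 1)) U + inner_h P (\<lambda>p. V (p - axis i 1)) U" for i
    using inner_h_shift[OF J U V, of i] inner_h_shift[OF J V U, of i]
      inner_h_commute[of P U "\<lambda>p. V (p - axis i 1)"] inner_h_commute[of P V "\<lambda>p. U (p - axis i 1)"]
    by linarith
  then show ?thesis
    by (simp only: expand inner_h_commute[of P U "Lap P V"] inner_h_commute[of P U V])
qed


section \<open>Functions of operators that are diagonal in the Fourier modes\<close>

lemma eigenspace_orthogonal:
  assumes "inner_h P (T U) W = inner_h P U (T W)"
    and "U \<in> eigenspace E T a" "W \<in> eigenspace E T b" "a \<noteq> b"
  shows "inner_h P U W = 0"
proof -
  have "inner_h P (T U) W = a * inner_h P U W"
    using assms(2) by (simp add: eigenspace_def inner_h_scale_left)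
  moreover have "inner_h P U (T W) = b * inner_h P U W"
    using assms(3) inner_h_commute[of P U] by (simp add: eigenspace_def inner_h_scale_left)
  ultimately show ?thesis using assms(1,4) by simp
qed

text \<open>
  The situation common to the two implicit operators of the scheme: a symmetric linear operator on
  a space of periodic grid functions, acting on the Fourier mode \<open>k\<close> as the scalar \<open>lam k\<close>.
  Different frequencies may share an eigenvalue.
\<close>

locale mode_diagonal =
  fixes P :: params
    and E :: "('d::finite, 'b::real_inner) grid_fun set"
    and T :: "('d, 'b) grid_fun \<Rightarrow> ('d, 'b) grid_fun"
    and lam :: "int ^ 'd \<Rightarrow> real"
  assumes J: "pJ P > 0" and mesh: "mesh P > 0"
    and E_periodic: "E \<subseteq> E_per (pJ P)"
    and E_0: "(\<lambda>p. 0) \<in> E"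
    and E_add: "\<And>U V. U \<in> E \<Longrightarrow> V \<in> E \<Longrightarrow> (\<lambda>p. U p + V p) \<in> E"
    and E_scale: "\<And>c U. U \<in> E \<Longrightarrow> (\<lambda>p. c *\<^sub>R U p) \<in> E"
    and mode_in_E: "\<And>k V. V \<in> E \<Longrightarrow> fourier_mode (pJ P) k V \<in> E"
    and T_add: "\<And>U V. T (\<lambda>p. U p + V p) = (\<lambda>p. T U p + T V p)"
    and T_scale: "\<And>c U. T (\<lambda>p. c *\<^sub>R U p) = (\<lambda>p. c *\<^sub>R T U p)"
    and T_symmetric: "\<And>U V. U \<in> E \<Longrightarrow> V \<in> E \<Longrightarrow> inner_h P (T U) V = inner_h P U (T V)"
    and T_mode: "\<And>k V. V \<in> E \<Longrightarrow>
          T (fourier_mode (pJ P) k V) = (\<lambda>p. lam k *\<^sub>R fourier_mode (pJ P) k V p)"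
begin

lemma E_lincomb:
  "finite I \<Longrightarrow> (\<And>k. k \<in> I \<Longrightarrow> W k \<in> E) \<Longrightarrow> (\<lambda>p. \<Sum>k\<in>I. c k *\<^sub>R W k p) \<in> E"
  by (induction I rule: finite_induct) (simp_all add: E_0 E_add E_scale)

lemma T_lincomb:
  "finite I \<Longrightarrow> T (\<lambda>p. \<Sum>k\<in>I. c k *\<^sub>R W k p) = (\<lambda>p. \<Sum>k\<in>I. c k *\<^sub>R T (W k) p)"
proof (induction I rule: finite_induct)
  case empty
  show ?case using T_scale[of 0 "\<lambda>p. 0"] by simp
qed (simp add: T_add T_scale)

lemma sum_modes: "V \<in> E \<Longrightarrow> (\<Sum>k\<in>grid_cell (pJ P). fourier_mode (pJ P) k V p) = V p"
  using sum_fourier_modes[OF J] E_periodic by blast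

lemma mode_eigenspace: "V \<in> E \<Longrightarrow> fourier_mode (pJ P) k V \<in> eigenspace E T (lam k)"
  by (simp add: eigenspace_def mode_in_E T_mode)

lemma E_definite: "U \<in> E \<Longrightarrow> inner_h P U U = 0 \<Longrightarrow> U p = 0"
  using inner_h_eq_0D[OF J mesh] E_periodic by blast

text \<open>
  The modes leave no room for further eigenvalues: an eigenfunction of a new eigenvalue would be
  orthogonal to all of its own modes, hence to itself.
\<close>

lemma eigenspace_eq_0:
  assumes "U \<in> eigenspace E T a" "a \<notin> lam ` grid_cell (pJ P)"
  shows "U = (\<lambda>p. 0)"
proof
  fix p
  have U: "U \<in> E" using assms(1) by (simp add: eigenspace_def)
  have "inner_h P (fourier_mode (pJ P) k U) U = 0" if "k \<in> grid_cell (pJ P)" for k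
    using that assms U
    by (intro eigenspace_orthogonal[OF T_symmetric mode_eigenspace assms(1)] mode_in_E) auto
  then have "inner_h P (\<lambda>p. \<Sum>k\<in>grid_cell (pJ P). fourier_mode (pJ P) k U p) U = 0"
    by (simp add: inner_h_sum_left)
  then show "U p = 0" using E_definite[OF U] by (simp add: sum_modes[OF U])
qed

text \<open>
  The modes with eigenvalue \<open>a\<close> add up to an element of the eigenspace, and the remaining ones are
  orthogonal to it by symmetry; an orthogonal projection is unique because the inner product is
  definite on periodic functions.
\<close>

lemma eigenproj_eq:
  assumes V: "V \<in> E"
  shows "eigenproj P E T a V =
    (\<lambda>p. \<Sum>k\<in>{k \<in> grid_cell (pJ P). lam k = a}. fourier_mode (pJ P) k V p)"
    (is "_ = ?W")
proof -
  let ?K = "{k \<in> grid_cell (pJ P). lam k = a}"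
  have W: "?W \<in> eigenspace E T a"
  proof -
    have "?W \<in> E"
      using E_lincomb[of ?K "\<lambda>k. fourier_mode (pJ P) k V" "\<lambda>_. 1"] mode_in_E[OF V] by simp
    moreover have "T ?W = (\<lambda>p. \<Sum>k\<in>?K. T (fourier_mode (pJ P) k V) p)"
      using T_lincomb[of ?K "\<lambda>_. 1" "\<lambda>k. fourier_mode (pJ P) k V"] by simp
    ultimately show ?thesis
      by (simp add: eigenspace_def T_mode[OF V] scaleR_sum_right)
  qed
  have VW: "(\<lambda>p. V p - ?W p)
      = (\<lambda>p. \<Sum>k\<in>{k \<in> grid_cell (pJ P). lam k \<noteq> a}. fourier_mode (pJ P) k V p)" (is "_ = ?R")
  proof
    fix p
    have "V p = ?W p + ?R p"
      unfolding sum_modes[OF V, of p, symmetric]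
      by (subst sum.union_disjoint[symmetric]) (auto intro: sum.cong)
    then show "V p - ?W p = ?R p" by simp
  qed
  have orth: "inner_h P (\<lambda>p. V p - ?W p) Z = 0" if Z: "Z \<in> eigenspace E T a" for Z
    unfolding VW inner_h_sum_left
  proof (rule sum.neutral, rule ballI)
    fix k assume k: "k \<in> {k \<in> grid_cell (pJ P). lam k \<noteq> a}"
    have "Z \<in> E" using Z by (simp add: eigenspace_def)
    then show "inner_h P (fourier_mode (pJ P) k V) Z = 0"
      using k by (intro eigenspace_orthogonal[OF T_symmetric mode_eigenspace[OF V] Z] mode_in_E V) auto
  qed
  show ?thesis
    unfolding eigenproj_def
  proof (rule the_equality)
    show "?W \<in> eigenspace E T a \<and> (\<forall>Z\<in>eigenspace E T a. inner_h P (\<lambda>p. V p - ?W p) Z = 0)"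
      using W orth by blast
  next
    fix W' assume W': "W' \<in> eigenspace E T a \<and>
        (\<forall>Z\<in>eigenspace E T a. inner_h P (\<lambda>p. V p - W' p) Z = 0)"
    have eq: "inner_h P W' Z = inner_h P ?W Z" if "Z \<in> eigenspace E T a" for Z
      using orth[OF that] W' that by (simp add: inner_h_diff_left)
    define D where "D = (\<lambda>p. W' p - ?W p)"
    have "inner_h P D W' = 0" "inner_h P D ?W = 0"
      unfolding D_def inner_h_diff_left using eq W W' by auto
    moreover have "inner_h P D D = inner_h P W' D - inner_h P ?W D"
      by (subst (1) D_def) (rule inner_h_diff_left)
    ultimately have "inner_h P D D = 0"
      using inner_h_commute[of P D W'] inner_h_commute[of P D ?W] by simp
    moreover have "D \<in> E_per (pJ P)"
      using W W' E_periodic unfolding D_def eigenspace_def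
      by (intro E_per_map2[where f = "(-)"]) auto
    ultimately have "D p = 0" for p using inner_h_eq_0D[OF J mesh] by blast
    then show "W' = ?W" by (auto simp: D_def)
  qed
qed

text \<open>
  Grouping the modes by eigenvalue turns the spectral definition into a sum over frequencies.
  Values of \<open>lam\<close> that are not eigenvalues only collect modes that vanish.
\<close>

lemma op_fun_modes:
  assumes V: "V \<in> E"
  shows "op_fun P E f T V =
    (\<lambda>p. \<Sum>k\<in>grid_cell (pJ P). f (lam k) *\<^sub>R fourier_mode (pJ P) k V p)"
proof
  fix p
  let ?M = "\<lambda>k. fourier_mode (pJ P) k V p"
  let ?K = "\<lambda>a. {k \<in> grid_cell (pJ P). lam k = a}"
  have ev: "eigenvalues E T \<subseteq> lam ` grid_cell (pJ P)"
    using eigenspace_eq_0 unfolding eigenvalues_def by blast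
  have "op_fun P E f T V p = (\<Sum>a\<in>eigenvalues E T. f a *\<^sub>R (\<Sum>k\<in>?K a. ?M k))"
    by (simp add: op_fun_def eigenproj_eq[OF V])
  also have "\<dots> = (\<Sum>a\<in>lam ` grid_cell (pJ P). f a *\<^sub>R (\<Sum>k\<in>?K a. ?M k))"
  proof (rule sum.mono_neutral_left)
    show "\<forall>a\<in>lam ` grid_cell (pJ P) - eigenvalues E T. f a *\<^sub>R (\<Sum>k\<in>?K a. ?M k) = 0"
    proof
      fix a assume a: "a \<in> lam ` grid_cell (pJ P) - eigenvalues E T"
      have "?M k = 0" if "k \<in> ?K a" for k
        using a that mode_eigenspace[OF V, of k] unfolding eigenvalues_def by force
      then show "f a *\<^sub>R (\<Sum>k\<in>?K a. ?M k) = 0" by simp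
    qed
  qed (use ev in auto)
  also have "\<dots> = (\<Sum>a\<in>lam ` grid_cell (pJ P). \<Sum>k\<in>?K a. f (lam k) *\<^sub>R ?M k)"
    by (simp add: scaleR_sum_right)
  also have "\<dots> = (\<Sum>k\<in>grid_cell (pJ P). f (lam k) *\<^sub>R ?M k)"
    by (rule sum.image_gen[symmetric]) simp
  finally show "op_fun P E f T V p = (\<Sum>k\<in>grid_cell (pJ P). f (lam k) *\<^sub>R ?M k)" .
qed

lemma op_fun_in_E: "V \<in> E \<Longrightarrow> op_fun P E f T V \<in> E"
  unfolding op_fun_modes by (intro E_lincomb mode_in_E) simp_all

end


section \<open>Exponential steps as limits of explicit Euler steps\<close>

context mode_diagonal
begin

text \<open>
  The exponential step is the limit of the explicit Euler iterates for \<open>Y' = - T Y + N\<close>, \<open>Y(0) = V\<close>,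
  whose component on a mode with eigenvalue \<open>\<lambda>\<close> is
  \<open>(1 - e \<lambda>)\<^sup>m V\<^sub>k + (1 - (1 - e \<lambda>)\<^sup>m) / \<lambda> N\<^sub>k\<close>.
  A ball that is preserved by all sufficiently short Euler steps is therefore preserved by the
  exponential step.
\<close>

lemma exponential_step_bound:
  assumes V: "V \<in> E" and N: "N \<in> E"
    and lam: "\<And>k. lam k \<noteq> 0" and tau: "tau > 0"
    and emax: "emax > 0"
    and step: "\<And>e U p. \<lbrakk>0 < e; e < emax; \<And>q. norm (U q) \<le> eta\<rbrakk> \<Longrightarrow>
          norm (U p - e *\<^sub>R T U p + e *\<^sub>R N p) \<le> eta"
    and V_le: "\<And>q. norm (V q) \<le> eta"
  shows "norm (op_fun P E (\<lambda>z. exp (- tau * z)) T V p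
           + tau *\<^sub>R op_fun P E (\<lambda>z. phi1 (- tau * z)) T N p) \<le> eta"
proof -
  let ?cell = "grid_cell (pJ P) :: (int ^ 'd) set"
  let ?v = "\<lambda>k. fourier_mode (pJ P) k V" and ?n = "\<lambda>k. fourier_mode (pJ P) k N"
  define Y where "Y e m = (\<lambda>p. (\<Sum>k\<in>?cell. (1 - e * lam k) ^ m *\<^sub>R ?v k p)
      + (\<Sum>k\<in>?cell. ((1 - (1 - e * lam k) ^ m) / lam k) *\<^sub>R ?n k p))" for e m
  have Y_0: "Y e 0 = V" for e
    by (simp add: Y_def sum_modes[OF V])
  have Y_Suc: "Y e (Suc m) p = Y e m p - e *\<^sub>R T (Y e m) p + e *\<^sub>R N p" for e m p
  proof -
    have TY: "T (Y e m) p = (\<Sum>k\<in>?cell. (1 - e * lam k) ^ m *\<^sub>R (lam k *\<^sub>R ?v k p))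
        + (\<Sum>k\<in>?cell. ((1 - (1 - e * lam k) ^ m) / lam k) *\<^sub>R (lam k *\<^sub>R ?n k p))"
      by (simp only: Y_def T_add T_lincomb[OF finite_grid_cell] T_mode[OF V] T_mode[OF N])
    have "(\<Sum>k\<in>?cell. (1 - e * lam k) ^ Suc m *\<^sub>R ?v k p)
        = (\<Sum>k\<in>?cell. (1 - e * lam k) ^ m *\<^sub>R ?v k p)
          - e *\<^sub>R (\<Sum>k\<in>?cell. (1 - e * lam k) ^ m *\<^sub>R (lam k *\<^sub>R ?v k p))"
      unfolding scaleR_sum_right sum_subtractf[symmetric]
    proof (rule sum.cong[OF refl])
      fix k
      have "(1 - e * lam k) ^ Suc m = (1 - e * lam k) ^ m - e * ((1 - e * lam k) ^ m * lam k)"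
        by (simp add: algebra_simps)
      then show "(1 - e * lam k) ^ Suc m *\<^sub>R ?v k p
          = (1 - e * lam k) ^ m *\<^sub>R ?v k p - e *\<^sub>R ((1 - e * lam k) ^ m *\<^sub>R (lam k *\<^sub>R ?v k p))"
        by (simp only: scaleR_scaleR scaleR_diff_left)
    qed
    moreover have "(\<Sum>k\<in>?cell. ((1 - (1 - e * lam k) ^ Suc m) / lam k) *\<^sub>R ?n k p)
        = (\<Sum>k\<in>?cell. ((1 - (1 - e * lam k) ^ m) / lam k) *\<^sub>R ?n k p)
          - e *\<^sub>R (\<Sum>k\<in>?cell. ((1 - (1 - e * lam k) ^ m) / lam k) *\<^sub>R (lam k *\<^sub>R ?n k p))
          + e *\<^sub>R (\<Sum>k\<in>?cell. ?n k p)"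
      unfolding scaleR_sum_right sum_subtractf[symmetric] sum.distrib[symmetric]
    proof (rule sum.cong[OF refl])
      fix k
      have "(1 - (1 - e * lam k) ^ Suc m) / lam k
          = (1 - (1 - e * lam k) ^ m) / lam k - e * ((1 - (1 - e * lam k) ^ m) / lam k * lam k) + e"
        using lam[of k] by (simp add: field_simps)
      then show "((1 - (1 - e * lam k) ^ Suc m) / lam k) *\<^sub>R ?n k p
          = ((1 - (1 - e * lam k) ^ m) / lam k) *\<^sub>R ?n k p
            - e *\<^sub>R (((1 - (1 - e * lam k) ^ m) / lam k) *\<^sub>R (lam k *\<^sub>R ?n k p)) + e *\<^sub>R ?n k p"
        by (simp only: scaleR_scaleR scaleR_diff_left scaleR_add_left)
    qed
    ultimately show ?thesis
      unfolding TY sum_modes[OF N] by (simp add: Y_def scaleR_add_right)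
  qed
  have Y_le: "norm (Y e m p) \<le> eta" if "0 < e" "e < emax" for e m p
  proof (induction m arbitrary: p)
    case 0
    show ?case using V_le by (simp add: Y_0)
  next
    case (Suc m)
    then show ?case unfolding Y_Suc by (intro step that)
  qed
  have lim_exp: "(\<lambda>m. (1 - tau / real m * lam k) ^ m) \<longlonglongrightarrow> exp (- tau * lam k)" for k
    using tendsto_exp_limit_sequentially[of "- tau * lam k"] by simp
  have "(\<lambda>m. Y (tau / real m) m p) \<longlonglongrightarrow> (\<Sum>k\<in>?cell. exp (- tau * lam k) *\<^sub>R ?v k p)
      + (\<Sum>k\<in>?cell. ((1 - exp (- tau * lam k)) / lam k) *\<^sub>R ?n k p)"
    unfolding Y_def by (intro tendsto_intros lim_exp lam)
  moreover have "(1 - exp (- tau * lam k)) / lam k = tau * phi1 (- tau * lam k)" for k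
    using tau lam[of k] by (simp add: phi1_def field_simps)
  ultimately have lim: "(\<lambda>m. Y (tau / real m) m p) \<longlonglongrightarrow>
      op_fun P E (\<lambda>z. exp (- tau * z)) T V p + tau *\<^sub>R op_fun P E (\<lambda>z. phi1 (- tau * z)) T N p"
    by (simp add: op_fun_modes[OF V] op_fun_modes[OF N] scaleR_sum_right)
  \<comment> \<open>For such \<open>m\<close> the step length \<open>tau / m\<close> lies below \<open>emax\<close>.\<close>
  have "eventually (\<lambda>m. real m > tau / emax) sequentially"
    using filterlim_real_sequentially by (simp add: filterlim_at_top_dense)
  then have "eventually (\<lambda>m. norm (Y (tau / real m) m p) \<le> eta) sequentially"
  proof eventually_elim
    case (elim m)
    moreover have "real m > 0"
      using elim tau emax by (meson divide_pos_pos less_trans)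
    ultimately show ?case using tau emax by (intro Y_le) (simp_all add: field_simps)
  qed
  then show ?thesis
    by (intro tendsto_upperbound[OF tendsto_norm[OF lim]]) simp_all
qed

end


section \<open>The operators of the scheme\<close>

lemma fourier_mode_in_subspace:
  assumes "subspace X" "\<And>p. V p \<in> X"
  shows "fourier_mode J k V p \<in> X"
  unfolding fourier_mode_def using assms by (intro subspace_scale subspace_sum) auto

text \<open>
  The values form a linear subspace of the matrices, so closure properties of the grid function space
  reduce to pointwise ones.
\<close>

lemma S_h_eq: "S_h J = {V \<in> E_per J. \<forall>p. V p \<in> {M. transpose M = M \<and> trace M = 0}}"
  by (auto simp: S_h_def)

lemma subspace_symmetric_traceless:
  "subspace {M :: real ^ 'd ^ 'd::finite. transpose M = M \<and> trace M = 0}"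
  unfolding subspace_def
  by (auto simp: transpose_def trace_def vec_eq_iff sum.distrib sum_distrib_left[symmetric])

lemma S_h_E_per: "V \<in> S_h J \<Longrightarrow> V \<in> E_per J"
  by (simp add: S_h_def)

lemma L_op_mode_diagonal:
  assumes "pJ P > 0" "mesh P > 0"
  shows "mode_diagonal P (S_h (pJ P) :: 'd::finite matrix_fun set) (L_op P g)
    (\<lambda>k. pK P * lap_symbol P k + g * pkappa1 P)"
proof
  show "(\<lambda>p. 0) \<in> (S_h (pJ P) :: 'd matrix_fun set)"
    using subspace_0[OF subspace_symmetric_traceless] by (simp add: S_h_eq E_per_const)
  show "(\<lambda>p. U p + V p) \<in> S_h (pJ P)"
    if "U \<in> S_h (pJ P)" "V \<in> S_h (pJ P)" for U V :: "'d matrix_fun"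
    using that subspace_add[OF subspace_symmetric_traceless] E_per_map2[of U "pJ P" V "(+)"]
    unfolding S_h_eq by blast
  show "(\<lambda>p. c *\<^sub>R U p) \<in> S_h (pJ P)" if "U \<in> S_h (pJ P)" for c and U :: "'d matrix_fun"
    using that subspace_scale[OF subspace_symmetric_traceless] E_per_map[of U "pJ P" "scaleR c"]
    unfolding S_h_eq by blast
  show "fourier_mode (pJ P) k V \<in> S_h (pJ P)" if "V \<in> S_h (pJ P)" for k and V :: "'d matrix_fun"
    using that fourier_mode_E_per[OF assms(1)]
      fourier_mode_in_subspace[OF subspace_symmetric_traceless, of V "pJ P" k]
    unfolding S_h_eq by blast
  show "inner_h P (L_op P g U) V = inner_h P U (L_op P g V)"
    if "U \<in> S_h (pJ P)" "V \<in> S_h (pJ P)" for U V :: "'d matrix_fun"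
  proof -
    have expand: "inner_h P (L_op P g X) Y
        = - pK P * inner_h P (Lap P X) Y + g * pkappa1 P * inner_h P X Y" for X Y :: "'d matrix_fun"
      unfolding L_op_def inner_h_add_left inner_h_scale_left ..
    show ?thesis
      using Lap_symmetric[OF assms(1) that[THEN S_h_E_per]]
      by (simp only: expand inner_h_commute[of P U "L_op P g V"] inner_h_commute[of P V U]
          inner_h_commute[of P "Lap P V" U])
  qed
  show "L_op P g (fourier_mode (pJ P) k V) =
      (\<lambda>p. (pK P * lap_symbol P k + g * pkappa1 P) *\<^sub>R fourier_mode (pJ P) k V p)"
    for k and V :: "'d matrix_fun"
    unfolding L_op_def Lap_fourier_mode by (simp add: algebra_simps)
qed (use assms in \<open>auto simp: S_h_E_per L_op_def Lap_add Lap_scale algebra_simps\<close>)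

lemma D_op_mode_diagonal:
  assumes "pJ P > 0" "mesh P > 0"
  shows "mode_diagonal P (E_per (pJ P) :: ('d::finite, real) grid_fun set) (D_op P g)
    (\<lambda>k. 2 * pB0 P * (lap_symbol P k)\<^sup>2 + g * pkappa2 P)"
proof
  show "(\<lambda>p. U p + V p) \<in> E_per (pJ P)"
    if "U \<in> E_per (pJ P)" "V \<in> E_per (pJ P)" for U V :: "('d, real) grid_fun"
    using that by (rule E_per_map2)
  show "(\<lambda>p. c *\<^sub>R U p) \<in> E_per (pJ P)" if "U \<in> E_per (pJ P)" for c and U :: "('d, real) grid_fun"
    using that by (rule E_per_map)
  show "D_op P g (\<lambda>p. c *\<^sub>R U p) = (\<lambda>p. c *\<^sub>R D_op P g U p)" for c and U :: "('d, real) grid_fun"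
    unfolding D_op_def Lap_scale by (simp add: algebra_simps)
  show "D_op P g (\<lambda>p. U p + V p) = (\<lambda>p. D_op P g U p + D_op P g V p)" for U V :: "('d, real) grid_fun"
    unfolding D_op_def Lap_add by (simp add: algebra_simps)
  show "inner_h P (D_op P g U) V = inner_h P U (D_op P g V)"
    if "U \<in> E_per (pJ P)" "V \<in> E_per (pJ P)" for U V :: "('d, real) grid_fun"
  proof -
    have expand: "inner_h P (D_op P g X) Y
        = 2 * pB0 P * inner_h P (Lap P (Lap P X)) Y + g * pkappa2 P * inner_h P X Y"
      for X Y :: "('d, real) grid_fun"
      unfolding D_op_def inner_h_add_left
        inner_h_scale_left[where 'b = real, unfolded real_scaleR_def] ..
    have "inner_h P (Lap P (Lap P U)) V = inner_h P (Lap P (Lap P V)) U"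
      using Lap_symmetric[OF assms(1) Lap_E_per[OF that(1)] that(2)]
        Lap_symmetric[OF assms(1) that(1) Lap_E_per[OF that(2)]]
      by (simp add: inner_h_commute[of P U])
    then show ?thesis
      by (simp only: expand inner_h_commute[of P U "D_op P g V"] inner_h_commute[of P V U])
  qed
  show "D_op P g (fourier_mode (pJ P) k V) =
      (\<lambda>p. (2 * pB0 P * (lap_symbol P k)\<^sup>2 + g * pkappa2 P) *\<^sub>R fourier_mode (pJ P) k V p)"
    for k and V :: "('d, real) grid_fun"
    unfolding D_op_def Lap_fourier_mode Lap_scale
    by (simp add: algebra_simps power2_eq_square)
qed (use assms in \<open>auto simp: E_per_const fourier_mode_E_per\<close>)


section \<open>The maximum principle for one step\<close>

text \<open>
  The smallness condition says that the weight of \<open>U p\<close> is nonnegative.  The \<open>2 d\<close> neighbours have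
  weight \<open>e K / h\<^sup>2\<close> each, and all weights together with \<open>e omega\<close>, the share of \<open>N\<close>, add up to \<open>1\<close>.
\<close>

lemma euler_step_bound:
  fixes U N :: "('d::finite, 'b::real_normed_vector) grid_fun"
  assumes "K \<ge> 0" "omega \<ge> 0" "e \<ge> 0"
    and small: "e * (omega + 2 * real CARD('d) * K / (mesh P)\<^sup>2) \<le> 1"
    and U: "\<And>q. norm (U q) \<le> eta" and N: "\<And>q. norm (N q) \<le> omega * eta"
  shows "norm (U p - e *\<^sub>R ((- K) *\<^sub>R Lap P U p + omega *\<^sub>R U p) + e *\<^sub>R N p) \<le> eta"
proof -
  define c where "c = e * K / (mesh P)\<^sup>2"
  define a where "a = 1 - e * (omega + 2 * real CARD('d) * K / (mesh P)\<^sup>2)"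
  define Z where "Z = (\<Sum>i\<in>UNIV. U (p + axis i 1) + U (p - axis i 1))"
  have c: "c \<ge> 0" and a: "a \<ge> 0"
    using assms by (auto simp: c_def a_def)
  have "(\<Sum>i\<in>UNIV. U (p + axis i 1) + U (p - axis i 1) - 2 *\<^sub>R U p)
      = Z - (2 * real CARD('d)) *\<^sub>R U p"
    by (simp add: Z_def sum_subtractf sum_constant_scaleR mult.commute)
  then have Lap: "Lap P U p = (Z - (2 * real CARD('d)) *\<^sub>R U p) /\<^sub>R (mesh P)\<^sup>2"
    by (simp only: Lap_eq)
  have "U p - e *\<^sub>R ((- K) *\<^sub>R Lap P U p + omega *\<^sub>R U p) + e *\<^sub>R N p
      = a *\<^sub>R U p + c *\<^sub>R Z + e *\<^sub>R N p"
    unfolding Lap by (simp add: a_def c_def divide_inverse algebra_simps)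
  moreover have "norm Z \<le> 2 * real CARD('d) * eta"
  proof -
    have "norm Z \<le> (\<Sum>i\<in>(UNIV :: 'd set). 2 * eta)"
      unfolding Z_def
    proof (rule sum_norm_le)
      fix i :: 'd
      show "norm (U (p + axis i 1) + U (p - axis i 1)) \<le> 2 * eta"
        using norm_triangle_ineq[of "U (p + axis i 1)" "U (p - axis i 1)"]
          U[of "p + axis i 1"] U[of "p - axis i 1"] by linarith
    qed
    then show ?thesis by (simp add: mult_ac)
  qed
  then have "norm (a *\<^sub>R U p + c *\<^sub>R Z + e *\<^sub>R N p)
      \<le> a * eta + c * (2 * real CARD('d) * eta) + e * (omega * eta)"
    using a c assms(3) U[of p] N[of p]
    by (intro norm_triangle_le add_mono) (simp_all add: mult_left_mono)
  moreover have "a * eta + c * (2 * real CARD('d) * eta) + e * (omega * eta) = eta"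
    by (simp add: a_def c_def algebra_simps)
  ultimately show ?thesis by simp
qed

lemma Q_next_bound:
  fixes Q :: "'d::finite matrix_fun"
  assumes J: "pJ P > 0" and mesh: "mesh P > 0" and K: "pK P > 0" and tau: "ptau P > 0"
    and omega: "g * pkappa1 P > 0"
    and Q: "Q \<in> S_h (pJ P)" and N: "N_Q P g Q u \<in> S_h (pJ P)"
    and Q_le: "\<And>q. norm (Q q) \<le> eta"
    and N_le: "\<And>q. norm (N_Q P g Q u q) \<le> g * pkappa1 P * eta"
  shows "norm (Q_next P g Q u p) \<le> eta"
proof -
  interpret mode_diagonal P "S_h (pJ P)" "L_op P g" "\<lambda>k. pK P * lap_symbol P k + g * pkappa1 P"
    by (rule L_op_mode_diagonal[OF J mesh])
  define R where "R = g * pkappa1 P + 2 * real CARD('d) * pK P / (mesh P)\<^sup>2"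
  have R: "R > 0"
    using omega K by (simp add: R_def add_pos_nonneg)
  show ?thesis
    unfolding Q_next_def
  proof (rule exponential_step_bound[OF Q N _ tau, where emax = "1 / R"])
    show "pK P * lap_symbol P k + g * pkappa1 P \<noteq> 0" for k :: "int ^ 'd"
      using omega K lap_symbol_nonneg[of P k] by (simp add: add_nonneg_pos less_imp_neq[symmetric])
    show "norm (U p - e *\<^sub>R L_op P g U p + e *\<^sub>R N_Q P g Q u p) \<le> eta"
      if "0 < e" "e < 1 / R" "\<And>q. norm (U q) \<le> eta" for e U p
    proof -
      have "e * R \<le> 1" using that(1,2) R by (simp add: field_simps)
      then show ?thesis
        unfolding L_op_def R_def using that K omega N_le by (intro euler_step_bound) simp_all
    qed
  qed (use R Q_le in auto)
qed


section \<open>Symmetry, tracelessness and periodicity of the nonlinear terms\<close>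

lemma symmetric_entry: "transpose M = M \<Longrightarrow> M $ i $ j = M $ j $ i"
  by (drule arg_cong[where f = "\<lambda>A. A $ j $ i"]) (simp add: transpose_def)

lemma traceless_part:
  fixes M :: "real ^ 'd ^ 'd::finite"
  assumes "transpose M = M"
  shows "M - (trace M / real CARD('d)) *\<^sub>R mat 1 \<in> {M. transpose M = M \<and> trace M = 0}"
proof -
  have "trace ((trace M / real CARD('d)) *\<^sub>R (mat 1 :: real ^ 'd ^ 'd)) = trace M"
    by (simp add: trace_def mat_def)
  then show ?thesis
    using symmetric_entry[OF assms] by (auto simp: trace_sub transpose_def mat_def vec_eq_iff)
qed

lemma D_c_E_per: "U \<in> E_per J \<Longrightarrow> D_c P k U \<in> E_per J"
  unfolding D_c_def
  by (intro E_per_map[where f = "\<lambda>x. x /\<^sub>R _"] E_per_map2[where f = "(-)"] E_per_translate)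

lemma D_c_commute: "D_c P k (D_c P l U) p = D_c P l (D_c P k U) p"
  unfolding D_c_def scaleR_diff_right[symmetric]
  by (simp add: algebra_simps)

lemma Hess_E_per: "u \<in> E_per J \<Longrightarrow> Hess P u \<in> E_per J"
  unfolding Hess_def by (rule E_perI) (simp add: E_perD D_c_E_per)

lemma transpose_Hess: "transpose (Hess P u p) = Hess P u p"
  by (simp add: Hess_def transpose_def D_c_commute)

lemma div_div_E_per: "\<Phi> \<in> E_per J \<Longrightarrow> div_div P \<Phi> \<in> E_per J"
  unfolding div_div_def
  by (intro E_per_sum D_c_E_per E_per_map[where f = "\<lambda>M. M $ _ $ _"])

lemma N_u_E_per:
  assumes "Q \<in> E_per J" "u \<in> E_per J"
  shows "N_u P g Q u \<in> E_per J"
proof -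
  have M: "M_h P Q \<in> E_per J"
    unfolding M_h_def by (rule E_per_map[OF assms(1)])
  have "div_div P (\<lambda>r. u r *\<^sub>R M_h P Q r) \<in> E_per J"
    by (intro div_div_E_per E_per_map2[where f = scaleR] assms(2) M)
  then show ?thesis
    unfolding N_u_def mu_h_def
    by (intro E_perI) (simp add: E_perD M assms Hess_E_per)
qed

lemma forcing_S_h:
  assumes "u \<in> E_per J"
  shows "forcing P u \<in> S_h J"
proof -
  have "forcing P u \<in> E_per J"
    unfolding forcing_def by (intro E_perI) (simp add: E_perD assms Hess_E_per)
  moreover have "transpose (u p *\<^sub>R Hess P u p) = u p *\<^sub>R Hess P u p" for p
    using transpose_Hess[of P u p] by (simp add: transpose_def vec_eq_iff)
  then have "forcing P u p \<in> {M. transpose M = M \<and> trace M = 0}" for p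
    unfolding forcing_def
    by (intro subspace_scale[OF subspace_symmetric_traceless] traceless_part)
  ultimately show ?thesis unfolding S_h_eq by blast
qed

lemma N_Q_S_h:
  fixes Q :: "'d::finite matrix_fun"
  assumes Q: "Q \<in> S_h J" and u: "u \<in> E_per J"
  shows "N_Q P g Q u \<in> S_h J"
proof -
  have F: "forcing P u \<in> S_h J" by (rule forcing_S_h[OF u])
  have "N_Q P g Q u \<in> E_per J"
    unfolding N_Q_def H_h_def
    by (intro E_perI) (simp add: E_perD S_h_E_per[OF Q] S_h_E_per[OF F] u)
  moreover have "N_Q P g Q u p \<in> {M. transpose M = M \<and> trace M = 0}" for p
  proof -
    have Qp: "Q p \<in> {M. transpose M = M \<and> trace M = 0}"
      and Fp: "forcing P u p \<in> {M. transpose M = M \<and> trace M = 0}"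
      using Q F unfolding S_h_eq by blast+
    have "transpose (Q p ** Q p) = Q p ** Q p"
      using Qp by (simp add: matrix_transpose_mul)
    then have Dp: "Q p ** Q p - (trace (Q p ** Q p) / real CARD('d)) *\<^sub>R mat 1
        \<in> {M. transpose M = M \<and> trace M = 0}"
      by (rule traceless_part)
    show ?thesis
      unfolding N_Q_def H_h_def
      by (intro Qp Fp Dp subspace_add[OF subspace_symmetric_traceless]
          subspace_diff[OF subspace_symmetric_traceless]
          subspace_scale[OF subspace_symmetric_traceless])
  qed
  ultimately show ?thesis unfolding S_h_eq by blast
qed


section \<open>The pointwise bound of the nonlinear term\<close>

lemma trace_square_symmetric:
  fixes M :: "real ^ 'd ^ 'd::finite"
  assumes "transpose M = M"
  shows "trace (M ** M) = (norm M)\<^sup>2"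
proof -
  have "trace (M ** M) = (\<Sum>i\<in>UNIV. \<Sum>j\<in>UNIV. M $ i $ j * M $ i $ j)"
    unfolding trace_def matrix_matrix_mult_def vec_lambda_beta
    by (intro sum.cong refl arg_cong2[where f = "(*)"] symmetric_entry[OF assms])
  then show ?thesis
    by (simp add: power2_norm_eq_inner inner_vec_def)
qed

text \<open>
  With \<open>\<sigma>\<close> the eigenvalues, \<open>\<Sum>\<sigma> = 0\<close> in dimension \<open>3\<close> forces \<open>\<Sum>\<sigma>\<^sup>4 = (\<Sum>\<sigma>\<^sup>2)\<^sup>2 / 2\<close>, and subtracting
  \<open>(\<Sum>\<sigma>\<^sup>2)\<^sup>2 / 3\<close> leaves \<open>(\<Sum>\<sigma>\<^sup>2)\<^sup>2 / 6\<close>.  The proof checks this as a polynomial identity in the five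
  free entries of the matrix, which avoids diagonalising it.
\<close>

lemma norm_deviator_square:
  fixes M :: "real ^ 'd ^ 'd::finite"
  assumes card: "CARD('d) = 3" and sym: "transpose M = M" and tr: "trace M = 0"
  shows "norm (M ** M - (trace (M ** M) / real CARD('d)) *\<^sub>R mat 1) = (norm M)\<^sup>2 / sqrt 6"
proof -
  obtain a b c :: 'd where univ: "UNIV = {a, b, c}" and ne: "a \<noteq> b" "a \<noteq> c" "b \<noteq> c"
    using card by (auto simp: card_3_iff)
  have sum3: "(\<Sum>i\<in>UNIV. f i) = f a + f b + f c" for f :: "'d \<Rightarrow> real"
    using ne by (simp add: univ)
  have sym': "M $ b $ a = M $ a $ b" "M $ c $ a = M $ a $ c" "M $ c $ b = M $ b $ c"
    by (rule symmetric_entry[OF sym])+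
  have Mcc: "M $ c $ c = - M $ a $ a - M $ b $ b"
    using tr by (simp add: trace_def sum3)
  define x y p q r where xs: "x = M $ a $ a" "y = M $ b $ b" "p = M $ a $ b" "q = M $ a $ c" "r = M $ b $ c"
  define D where "D = M ** M - (trace (M ** M) / 3) *\<^sub>R mat 1"
  have M2: "(M ** M) $ i $ j = M $ i $ a * M $ a $ j + M $ i $ b * M $ b $ j + M $ i $ c * M $ c $ j" for i j
    by (simp add: matrix_matrix_mult_def sum3)
  have nM: "(norm M)\<^sup>2 = 2 * (x\<^sup>2 + y\<^sup>2 + x * y + p\<^sup>2 + q\<^sup>2 + r\<^sup>2)"
    unfolding power2_norm_eq_inner inner_vec_def sum3 inner_real_def sym' Mcc xs[symmetric]
    by (simp add: power2_eq_square algebra_simps)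
  have t: "trace (M ** M) = 2 * (x\<^sup>2 + y\<^sup>2 + x * y + p\<^sup>2 + q\<^sup>2 + r\<^sup>2)"
    using trace_square_symmetric[OF sym] nM by simp
  have D_entry: "D $ i $ j = (M ** M) $ i $ j
      - (if i = j then 2 * (x\<^sup>2 + y\<^sup>2 + x * y + p\<^sup>2 + q\<^sup>2 + r\<^sup>2) / 3 else 0)" for i j
    by (simp add: D_def t mat_def)
  have nD: "(norm D)\<^sup>2 = (\<Sum>i\<in>UNIV. \<Sum>j\<in>UNIV. D $ i $ j * D $ i $ j)"
    by (simp add: power2_norm_eq_inner inner_vec_def)
  have "(norm D)\<^sup>2 = ((norm M)\<^sup>2)\<^sup>2 / 6"
    unfolding nM nD sum3 D_entry M2 sym' Mcc xs[symmetric]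
    using ne by (simp add: power2_eq_square field_simps)
  also have "\<dots> = ((norm M)\<^sup>2 / sqrt 6)\<^sup>2"
    by (simp add: power_divide)
  finally show ?thesis
    unfolding card D_def by (simp add: power2_eq_iff_nonneg)
qed

text \<open>
  Where \<open>kappa0\<close> comes from: \<open>kA\<close> keeps the coefficient of \<open>Q p\<close> nonnegative, so that the triangle
  inequality produces \<open>\<kappa>\<^sub>1 r + f\<^sub>d(r)\<close> with \<open>r = norm (Q p)\<close>, and \<open>kd\<close> is the monotonicity of this
  expression, which moves the evaluation from \<open>r\<close> to \<open>eta\<close>.  Replacing \<open>A_tilde\<close> by \<open>pA P\<close> only
  increases the bound, as the term quadratic in \<open>u p\<close> is nonnegative.
\<close>

lemma N_Q_bound:
  fixes Q :: "'d::finite matrix_fun"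
  assumes adm: "admissible CARD('d) P" and g: "g \<ge> 0"
    and sym: "transpose (Q p) = Q p" and tr: "trace (Q p) = 0"
    and Q_le: "norm (Q p) \<le> eta"
    and F_le: "norm (forcing P u p) \<le> S"
    and fd: "- pA P * eta + b_coef CARD('d) P * eta\<^sup>2 - pC P * eta ^ 3 + S \<le> 0"
    and kA: "A_tilde P u p + pC P * eta\<^sup>2 \<le> pkappa1 P"
    and kd: "\<And>x. 0 \<le> x \<Longrightarrow> x \<le> eta \<Longrightarrow>
      pA P - 2 * b_coef CARD('d) P * x + 3 * pC P * x\<^sup>2 \<le> pkappa1 P"
  shows "norm (N_Q P g Q u p) \<le> g * pkappa1 P * eta"
proof -
  define r where "r = norm (Q p)"
  define t where "t = A_tilde P u p - pA P"
  define D where "D = Q p ** Q p - (trace (Q p ** Q p) / real CARD('d)) *\<^sub>R mat 1"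
  define b where "b = b_coef CARD('d) P"
  have r: "0 \<le> r" "r \<le> eta" using Q_le by (auto simp: r_def)
  have C: "pC P > 0" using adm by (simp add: admissible_def)
  have t: "t \<ge> 0"
    using adm by (simp add: t_def A_tilde_def admissible_def)
  have BD: "norm (Bcoef CARD('d) P *\<^sub>R D) \<le> b * r\<^sup>2"
  proof (cases "CARD('d) = 3")
    case True
    then show ?thesis
      using norm_deviator_square[OF True sym tr]
      by (simp add: Bcoef_def b_def b_coef_def D_def r_def)
  qed (simp add: Bcoef_def b_def b_coef_def)
  have coeff: "pkappa1 P - pA P - t - pC P * r\<^sup>2 \<ge> 0"
  proof -
    have "pC P * r\<^sup>2 \<le> pC P * eta\<^sup>2"
      using C r by (simp add: power_mono)
    then show ?thesis using kA by (simp add: t_def)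
  qed
  have "N_Q P g Q u p = g *\<^sub>R ((pkappa1 P - pA P - t - pC P * r\<^sup>2) *\<^sub>R Q p
      + Bcoef CARD('d) P *\<^sub>R D - forcing P u p)"
    unfolding N_Q_def H_h_def D_def[symmetric]
    unfolding trace_square_symmetric[OF sym] r_def[symmetric]
    by (simp add: t_def A_tilde_def algebra_simps)
  then have "norm (N_Q P g Q u p) = g * norm ((pkappa1 P - pA P - t - pC P * r\<^sup>2) *\<^sub>R Q p
      + Bcoef CARD('d) P *\<^sub>R D - forcing P u p)"
    using g by simp
  also have "\<dots> \<le> g * (pkappa1 P * eta)"
  proof (rule mult_left_mono[OF _ g])
    have "norm ((pkappa1 P - pA P - t - pC P * r\<^sup>2) *\<^sub>R Q p + Bcoef CARD('d) P *\<^sub>R D - forcing P u p)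
        \<le> norm ((pkappa1 P - pA P - t - pC P * r\<^sup>2) *\<^sub>R Q p) + norm (Bcoef CARD('d) P *\<^sub>R D)
          + norm (forcing P u p)"
      by (meson add_right_mono norm_triangle_ineq norm_triangle_ineq4 order_trans)
    also have "\<dots> \<le> (pkappa1 P - pA P - t - pC P * r\<^sup>2) * r + b * r\<^sup>2 + S"
      using coeff BD F_le by (intro add_mono) (auto simp: r_def)
    also have "\<dots> \<le> (pkappa1 P - pA P) * r + b * r\<^sup>2 - pC P * r ^ 3 + S"
      using t r(1) by (simp add: algebra_simps power2_eq_square power3_eq_cube)
    also have "\<dots> \<le> (pkappa1 P - pA P) * eta + b * eta\<^sup>2 - pC P * eta ^ 3 + S"
    proof -
      let ?h = "\<lambda>x. (pkappa1 P - pA P) * x + b * x\<^sup>2 - pC P * x ^ 3"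
      have "?h r \<le> ?h eta"
      proof (rule DERIV_nonneg_imp_nondecreasing[OF r(2)])
        fix x assume x: "r \<le> x" "x \<le> eta"
        have "DERIV ?h x :> (pkappa1 P - pA P) + b * (2 * x) - pC P * (3 * x\<^sup>2)"
          by (auto intro!: derivative_eq_intros simp: power2_eq_square)
        moreover have "(pkappa1 P - pA P) + b * (2 * x) - pC P * (3 * x\<^sup>2) \<ge> 0"
          using kd[of x] x r(1) by (simp add: b_def algebra_simps)
        ultimately show "\<exists>y. DERIV ?h x :> y \<and> 0 \<le> y" by blast
      qed
      then show ?thesis by simp
    qed
    also have "\<dots> \<le> pkappa1 P * eta"
      using fd by (simp add: b_def algebra_simps)
    finally show "norm ((pkappa1 P - pA P - t - pC P * r\<^sup>2) *\<^sub>R Q p + Bcoef CARD('d) P *\<^sub>R D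
        - forcing P u p) \<le> pkappa1 P * eta" .
  qed
  finally show ?thesis by (simp add: mult_ac)
qed


section \<open>Invariance of the ball along the scheme\<close>

theorem theorem4p5:
  fixes P :: params
    and Q :: "nat \<Rightarrow> 'd::finite matrix_fun"
    and u :: "nat \<Rightarrow> ('d, real) grid_fun"
    and s :: "nat \<Rightarrow> real"
    and G \<eta> :: real
  assumes "admissible CARD('d) P"
    and "EOP_GSAV_EI P Q u s"
    and "G > 0"
    and "\<And>n. g_fac P (Q n) (u n) (s n) \<ge> G"
    and "S_bound P u < \<infinity>"
    and "\<eta> > 0"
    and "f_d CARD('d) P (S_bound P u) \<eta> \<le> 0"
    and "norm_inf P (Q 0) \<le> \<eta>"
    and "ereal (pkappa1 P) \<ge> ereal (1 / G) * kappa0 P u \<eta>"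
  shows "\<forall>n. norm_inf P (Q n) \<le> \<eta>"
proof -
  let ?J = "pJ P"
  define g where "g n = g_fac P (Q n) (u n) (s n)" for n
  have J: "?J > 0" and mesh: "mesh P > 0" and K: "pK P > 0" and tau: "ptau P > 0"
    and k1: "pkappa1 P > 0"
    using assms(1) by (auto simp: admissible_def mesh_def)
  have Q_Suc: "Q (Suc n) = Q_next P (g n) (Q n) (u n)"
    and u_Suc: "u (Suc n) = u_next P (g n) (Q n) (u n)" for n
    using assms(2) by (simp_all add: EOP_GSAV_EI_def Let_def g_def)
  have g_pos: "g n > 0" for n
    by (simp add: g_def g_fac_def)
  \<comment> \<open>The scheme starts with \<open>s\<^sup>0 = E\<^sub>1\<^sub>h\<^sup>0\<close>, so the scalar factor of the first step is \<open>1\<close>.\<close>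
  have "G \<le> 1"
    using assms(4)[of 0] assms(2) by (simp add: EOP_GSAV_EI_def g_fac_def)
  \<comment> \<open>The factor \<open>1 / G \<ge> 1\<close> can only increase a nonnegative bound, and a negative one is trivial.\<close>
  have kappa0_le: "x \<le> pkappa1 P" if "ereal x \<le> kappa0 P u \<eta>" for x
  proof (cases "x \<le> 0")
    case False
    have "ereal (x / G) \<le> ereal (1 / G) * kappa0 P u \<eta>"
      using ereal_mult_left_mono[OF that, of "ereal (1 / G)"] assms(3) by simp
    then have "x / G \<le> pkappa1 P"
      using assms(9) by (metis ereal_less_eq(3) order_trans)
    then have "x \<le> G * pkappa1 P" using assms(3) by (simp add: field_simps)
    also have "\<dots> \<le> pkappa1 P" using \<open>G \<le> 1\<close> k1 by simp
    finally show ?thesis .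
  qed (use k1 in simp)
  \<comment> \<open>Membership is what gives access to \<open>op_fun_modes\<close> at the next step.\<close>
  have spaces: "Q n \<in> S_h ?J \<and> u n \<in> E_per ?J" for n
  proof (induction n)
    case 0
    show ?case using assms(2) by (simp add: EOP_GSAV_EI_def)
  next
    case (Suc n)
    interpret L: mode_diagonal P "S_h ?J" "L_op P (g n)" "\<lambda>k. pK P * lap_symbol P k + g n * pkappa1 P"
      by (rule L_op_mode_diagonal[OF J mesh])
    interpret D: mode_diagonal P "E_per ?J" "D_op P (g n)"
      "\<lambda>k. 2 * pB0 P * (lap_symbol P k)\<^sup>2 + g n * pkappa2 P"
      by (rule D_op_mode_diagonal[OF J mesh])
    have "Q (Suc n) \<in> S_h ?J"
      unfolding Q_Suc Q_next_def using Suc.IH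
      by (intro L.E_add L.E_scale L.op_fun_in_E N_Q_S_h) auto
    moreover have "u (Suc n) \<in> E_per ?J"
      unfolding u_Suc u_next_def using Suc.IH S_h_E_per
      by (intro D.E_add D.E_scale[unfolded real_scaleR_def] D.op_fun_in_E N_u_E_per) auto
    ultimately show ?case ..
  qed
  have S_bound_ge: "ereal (norm_inf P (forcing P (u n))) \<le> S_bound P u" for n
    unfolding S_bound_def by (rule SUP_upper) simp
  then obtain S where S: "S_bound P u = ereal S"
    using assms(5) by (cases "S_bound P u") auto
  have F_le: "norm (forcing P (u n) p) \<le> S" for n p
    using S_bound_ge[of n] norm_inf_le_iff[OF J S_h_E_per[OF forcing_S_h]] spaces[of n]
    unfolding S ereal_less_eq by blast
  have fd: "- pA P * \<eta> + b_coef CARD('d) P * \<eta>\<^sup>2 - pC P * \<eta> ^ 3 + S \<le> 0"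
    using assms(7) by (simp add: f_d_def S zero_ereal_def)
  have kA: "A_tilde P (u n) p + pC P * \<eta>\<^sup>2 \<le> pkappa1 P" for n p
  proof -
    obtain r where r: "r \<in> grid_cell ?J" "u n p = u n r"
      using E_per_obtain_cell[OF J] spaces by metis
    have "ereal (A_tilde P (u n) r) \<le> (SUP n. SUP p\<in>grid_points ?J. ereal (A_tilde P (u n) p))"
      using r(1) grid_cell_subset_points by (intro SUP_upper2[of n] SUP_upper) auto
    then have "ereal (A_tilde P (u n) r + pC P * \<eta>\<^sup>2) \<le> kappa0 P u \<eta>"
      unfolding kappa0_def plus_ereal.simps(1)[symmetric] by (intro max.coboundedI1 add_right_mono)
    then show ?thesis using kappa0_le r(2) by (simp add: A_tilde_def)
  qed
  have kd: "pA P - 2 * b_coef CARD('d) P * x + 3 * pC P * x\<^sup>2 \<le> pkappa1 P"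
    if "0 \<le> x" "x \<le> \<eta>" for x
    using that unfolding kappa0_def
    by (intro kappa0_le[unfolded kappa0_def] max.coboundedI2 SUP_upper) auto
  have "norm (Q n p) \<le> \<eta>" for n p
  proof (induction n arbitrary: p)
    case 0
    show ?case using assms(8) norm_inf_le_iff[OF J S_h_E_per] spaces[of 0] by blast
  next
    case (Suc n)
    have "norm (N_Q P (g n) (Q n) (u n) q) \<le> g n * pkappa1 P * \<eta>" for q
      using spaces[of n] g_pos[of n]
      by (intro N_Q_bound[OF assms(1) _ _ _ Suc.IH F_le fd kA kd]) (auto simp: S_h_def)
    then show ?case
      unfolding Q_Suc using spaces[of n] g_pos[of n] k1
      by (intro Q_next_bound[OF J mesh K tau] N_Q_S_h Suc.IH) auto
  qed
  then show ?thesis using norm_inf_le_iff[OF J S_h_E_per] spaces by blast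
qed

end
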